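(* Let $1\le m\le n$ and fix a hybridization $\beta\in\{\mathsf w,\mathsf e\}^m$; write $G_\pi=G^\beta_\pi$. Then: (a) if $\pi\in\mathfrak S_{m,n}$ is decreasing ($\pi(1)>\pi(2)>\dots>\pi(m)$), then \[G_\pi=\prod_{i=1}^m\Big((A+B)\prod_{j=1}^{\pi(i)-1}(A+x_i-y_j)\prod_{j=\pi(i)+1}^{n}(B-x_i+y_j)\Big);\] (b) for $\pi\in\mathfrak S_{m,n}$ and $1\le i<m$, letting $\pi'=\pi\circ r_i$ (i.e. $\pi$ with the values $\pi(i),\pi(i+1)$ exchanged), \[G_\pi=\frac{1}{x_i-x_{i+1}}\Big((A+B)\,G_{\pi'}-(A+B+x_i-x_{i+1})\,r_iG_{\pi'}\Big),\] where $r_i$ acts on polynomials by exchanging $x_i$ and $x_{i+1}$. Moreover, the family $(G_\pi)_{\pi\in\mathfrak S_{m,n}}$ is uniquely determined by (a) and (b).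
   Context: Fix $1\le m\le n$. $\mathfrak S_{m,n}$ is the set of injective maps $\{1,\dots,m\}\to\{1,\dots,n\}$; $r_i$ is the transposition $(i\ i+1)$. A hybridization is $\beta\in\{\mathsf w,\mathsf e\}^m$; row $i$ of an $m\times n$ grid has type $\beta_i$. A hybrid generic pipe dream of type $\beta$ is a filling of the grid with tiles (unit squares in which pipes join edge midpoints). Rows of type $\mathsf w$ allow: blank; straight tiles horizontal (West–East), vertical (South–North), cross; elbow tiles: West–North, South–East, and the double elbow (both). Rows of type $\mathsf e$ allow: blank; the same straight tiles; elbow tiles East–North, South–West, and the double elbow (both). Conditions: no pipe starts or ends inside the grid; each $\mathsf w$ row has a pipe entering through its West boundary edge and none exiting East; each $\mathsf e$ row has a pipe entering through its East boundary edge and none exiting West; no pipe crosses the South boundary; double crossings are allowed. Pipes are numbered counterclockwise from the northwest corner (West-entering pipes $1,\dots,k$ top to bottom, then East-entering pipes $k+1,\dots,m$ bottom to top); $\varphi(i)$ is the number of the pipe entering in row $i$; the connectivity is $\pi\in\mathfrak S_{m,n}$ with pipe $i$ exiting the North side in column $\pi(i)$. Tile weights: elbows $A+B$; if $\beta_i=\mathsf w$: blank at $(i,j)$ gives $B-x_{\varphi(i)}+y_j$, straight gives $A+x_{\varphi(i)}-y_j$; if $\beta_i=\mathsf e$: blank gives $A+x_{\varphi(i)}-y_j$, straight gives $B-x_{\varphi(i)}+y_j$. $G^\beta_\pi\in\mathbb Z[x_1,\dots,x_m,y_1,\dots,y_n,A,B]$ is the sum over pipe dreams of type $\beta$ with connectivity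 $\pi$ of the product of tile weights. *)

theory Defs
  imports
    "HOL-Library.Poly_Mapping"
    "HOL-Library.FuncSet"
    "HOL-Combinatorics.Transposition"
    "HOL-Computational_Algebra.Polynomial_Factorial"
begin

section \<open>The polynomial ring\<close>

datatype indet = Ind_x nat | Ind_y nat | Ind_A | Ind_B

text \<open>The order on the indeterminates has no mathematical meaning; it is needed only because
  the \<^class>\<open>idom\<close> instance of \<^type>\<open>poly_mapping\<close> asks for linearly ordered monomials.\<close>

primrec indet_code :: "indet \<Rightarrow> nat" where
  "indet_code (Ind_x i) = 4 * i"
| "indet_code (Ind_y j) = 4 * j + 1"
| "indet_code Ind_A = 2"
| "indet_code Ind_B = 3"

lemma indet_code_eq_iff [simp]: "indet_code u = indet_code v \<longleftrightarrow> u = v"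
  by (cases u; cases v; simp; presburger)

instantiation indet :: linorder
begin

definition less_eq_indet :: "indet \<Rightarrow> indet \<Rightarrow> bool" where
  "u \<le> v \<longleftrightarrow> indet_code u \<le> indet_code v"

definition less_indet :: "indet \<Rightarrow> indet \<Rightarrow> bool" where
  "u < v \<longleftrightarrow> indet_code u < indet_code v"

instance
  by intro_classes (auto simp: less_eq_indet_def less_indet_def)

end

text \<open>Finitely supported maps from monomials (exponent vectors) to integer coefficients.\<close>

type_synonym zpoly = "(indet \<Rightarrow>\<^sub>0 nat) \<Rightarrow>\<^sub>0 int"

definition indet_poly :: "indet \<Rightarrow> zpoly" where
  "indet_poly v = Poly_Mapping.single (Poly_Mapping.single v 1) 1"

abbreviation pX :: "nat \<Rightarrow> zpoly" where "pX i \<equiv> indet_poly (Ind_x i)"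
abbreviation pY :: "nat \<Rightarrow> zpoly" where "pY j \<equiv> indet_poly (Ind_y j)"
abbreviation pA :: zpoly where "pA \<equiv> indet_poly Ind_A"
abbreviation pB :: zpoly where "pB \<equiv> indet_poly Ind_B"

text \<open>The subring \<open>\<int>[x\<^sub>1,\<dots>,x\<^sub>m,y\<^sub>1,\<dots>,y\<^sub>n,A,B]\<close>.\<close>

definition poly_ring :: "nat \<Rightarrow> nat \<Rightarrow> zpoly set" where
  "poly_ring m n = {p. \<forall>\<mu>\<in>Poly_Mapping.keys p.
     Poly_Mapping.keys \<mu> \<subseteq> Ind_x ` {1..m} \<union> Ind_y ` {1..n} \<union> {Ind_A, Ind_B}}"

text \<open>The action of \<open>r\<^sub>i\<close>: the coefficient of a monomial \<open>\<mu>\<close> in the result is the coefficient in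
  \<open>p\<close> of \<open>\<mu>\<close> with the exponents of \<open>x\<^sub>i\<close> and \<open>x\<^sub>i\<^sub>+\<^sub>1\<close> exchanged.\<close>

definition swap_x :: "nat \<Rightarrow> zpoly \<Rightarrow> zpoly" where
  "swap_x i = Poly_Mapping.map_key (Poly_Mapping.map_key (transpose (Ind_x i) (Ind_x (Suc i))))"

section \<open>Tiles and hybrid generic pipe dreams\<close>

datatype side = North | South | East | West

text \<open>A tile is the set of its pipe segments, a segment being the set of the two sides of the
  unit square whose midpoints it joins.\<close>

type_synonym tile = "side set set"

datatype row_type = w_row | e_row

definition blank :: tile where
  "blank = {}"

definition straight_tiles :: "tile set" where
  "straight_tiles = {{{West, East}}, {{South, North}}, {{West, East}, {South, North}}}"

primrec elbow_tiles :: "row_type \<Rightarrow> tile set" where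
  "elbow_tiles w_row = {{{West, North}}, {{South, East}}, {{West, North}, {South, East}}}"
| "elbow_tiles e_row = {{{East, North}}, {{South, West}}, {{East, North}, {South, West}}}"

definition tiles :: "row_type \<Rightarrow> tile set" where
  "tiles t = {blank} \<union> straight_tiles \<union> elbow_tiles t"

text \<open>Cell \<open>(i, j)\<close> is in row \<open>i\<close>, counted from the North, and column \<open>j\<close>, counted from the West.\<close>

definition grid :: "nat \<Rightarrow> nat \<Rightarrow> (nat \<times> nat) set" where
  "grid m n = {1..m} \<times> {1..n}"

type_synonym filling = "nat \<times> nat \<Rightarrow> tile"

definition touches :: "filling \<Rightarrow> nat \<times> nat \<Rightarrow> side \<Rightarrow> bool" where
  "touches P c s \<longleftrightarrow> s \<in> \<Union>(P c)"

text \<open>The first two conditions on touched edges say that no pipe starts or ends inside the grid.\<close>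

definition pipe_dreams :: "nat \<Rightarrow> nat \<Rightarrow> (nat \<Rightarrow> row_type) \<Rightarrow> filling set" where
  "pipe_dreams m n \<beta> = {P \<in> (\<Pi>\<^sub>E (i, j)\<in>grid m n. tiles (\<beta> i)).
     (\<forall>i\<in>{1..m}. \<forall>j\<in>{1..<n}. touches P (i, j) East \<longleftrightarrow> touches P (i, Suc j) West) \<and>
     (\<forall>i\<in>{1..<m}. \<forall>j\<in>{1..n}. touches P (i, j) South \<longleftrightarrow> touches P (Suc i, j) North) \<and>
     (\<forall>i\<in>{1..m}. \<beta> i = w_row \<longrightarrow> touches P (i, 1) West \<and> \<not> touches P (i, n) East) \<and>
     (\<forall>i\<in>{1..m}. \<beta> i = e_row \<longrightarrow> touches P (i, n) East \<and> \<not> touches P (i, 1) West) \<and>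
     (\<forall>j\<in>{1..n}. \<not> touches P (m, j) South)}"

section \<open>Numbering and connectivity of the pipes\<close>

text \<open>The number \<open>\<phi>(i)\<close> of the pipe entering in row \<open>i\<close>.\<close>

definition pipe_number :: "nat \<Rightarrow> (nat \<Rightarrow> row_type) \<Rightarrow> nat \<Rightarrow> nat" where
  "pipe_number m \<beta> i = (case \<beta> i of
      w_row \<Rightarrow> card {i'\<in>{1..i}. \<beta> i' = w_row}
    | e_row \<Rightarrow> card {i'\<in>{1..m}. \<beta> i' = w_row} + card {i'\<in>{i..m}. \<beta> i' = e_row})"

text \<open>Coordinates of the edge midpoints, in half units, the centre of cell \<open>(i, j)\<close> being
  \<open>(2 * i, 2 * j)\<close>. The two cells that share an edge give the same coordinates for it, so
  a pipe is traced by following segments from midpoint to midpoint.\<close>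

fun midpoint :: "nat \<times> nat \<Rightarrow> side \<Rightarrow> nat \<times> nat" where
  "midpoint (i, j) North = (2 * i - 1, 2 * j)"
| "midpoint (i, j) South = (2 * i + 1, 2 * j)"
| "midpoint (i, j) West = (2 * i, 2 * j - 1)"
| "midpoint (i, j) East = (2 * i, 2 * j + 1)"

definition segments :: "nat \<Rightarrow> nat \<Rightarrow> filling \<Rightarrow> ((nat \<times> nat) \<times> (nat \<times> nat)) set" where
  "segments m n P = {(midpoint c s, midpoint c t) | c s t. c \<in> grid m n \<and> {s, t} \<in> P c}"

definition entry_point :: "nat \<Rightarrow> (nat \<Rightarrow> row_type) \<Rightarrow> nat \<Rightarrow> nat \<times> nat" where
  "entry_point n \<beta> i = (case \<beta> i of w_row \<Rightarrow> midpoint (i, 1) West | e_row \<Rightarrow> midpoint (i, n) East)"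

text \<open>\<open>\<SS>\<^sub>m\<^sub>,\<^sub>n\<close>; the maps are extensional, so that each injection is represented once.\<close>

definition partial_perms :: "nat \<Rightarrow> nat \<Rightarrow> (nat \<Rightarrow> nat) set" where
  "partial_perms m n = {\<pi> \<in> {1..m} \<rightarrow>\<^sub>E {1..n}. inj_on \<pi> {1..m}}"

definition has_connectivity ::
  "nat \<Rightarrow> nat \<Rightarrow> (nat \<Rightarrow> row_type) \<Rightarrow> filling \<Rightarrow> (nat \<Rightarrow> nat) \<Rightarrow> bool" where
  "has_connectivity m n \<beta> P \<pi> \<longleftrightarrow> (\<forall>i\<in>{1..m}.
     (entry_point n \<beta> i, midpoint (1, \<pi> (pipe_number m \<beta> i)) North) \<in> (segments m n P)\<^sup>*)"

section \<open>Weights and generating polynomials\<close>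

definition tile_weight :: "nat \<Rightarrow> (nat \<Rightarrow> row_type) \<Rightarrow> filling \<Rightarrow> nat \<times> nat \<Rightarrow> zpoly" where
  "tile_weight m \<beta> P = (\<lambda>(i, j).
     let a = pA + pX (pipe_number m \<beta> i) - pY j;
         b = pB - pX (pipe_number m \<beta> i) + pY j
     in if P (i, j) \<in> elbow_tiles (\<beta> i) then pA + pB
        else if P (i, j) = blank then (case \<beta> i of w_row \<Rightarrow> b | e_row \<Rightarrow> a)
        else (case \<beta> i of w_row \<Rightarrow> a | e_row \<Rightarrow> b))"

definition G_poly :: "nat \<Rightarrow> nat \<Rightarrow> (nat \<Rightarrow> row_type) \<Rightarrow> (nat \<Rightarrow> nat) \<Rightarrow> zpoly" where
  "G_poly m n \<beta> \<pi> =
     (\<Sum>P\<in>{P \<in> pipe_dreams m n \<beta>. has_connectivity m n \<beta> P \<pi>}. \<Prod>c\<in>grid m n. tile_weight m \<beta> P c)"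

section \<open>The two conditions on a family of polynomials\<close>

definition decreasing_formula :: "nat \<Rightarrow> nat \<Rightarrow> ((nat \<Rightarrow> nat) \<Rightarrow> zpoly) \<Rightarrow> bool" where
  "decreasing_formula m n F \<longleftrightarrow>
     (\<forall>\<pi>\<in>partial_perms m n. strict_antimono_on {1..m} \<pi> \<longrightarrow>
        F \<pi> = (\<Prod>i\<in>{1..m}. (pA + pB) * (\<Prod>j\<in>{1..<\<pi> i}. pA + pX i - pY j)
                                      * (\<Prod>j\<in>{\<pi> i<..n}. pB - pX i + pY j)))"

text \<open>The division takes place in the fraction field; \<^const>\<open>to_fract\<close> is the embedding of the
  polynomial ring.\<close>

definition exchange_formula :: "nat \<Rightarrow> nat \<Rightarrow> ((nat \<Rightarrow> nat) \<Rightarrow> zpoly) \<Rightarrow> bool" where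
  "exchange_formula m n F \<longleftrightarrow>
     (\<forall>\<pi>\<in>partial_perms m n. \<forall>i\<in>{1..<m}. let \<pi>' = \<pi> \<circ> transpose i (Suc i) in
        to_fract (F \<pi>) = 1 / to_fract (pX i - pX (Suc i)) *
          to_fract ((pA + pB) * F \<pi>' - (pA + pB + pX i - pX (Suc i)) * swap_x i (F \<pi>')))"

end

theory Submission
  imports Defs
begin

text \<open>
  Label every edge by the number of its pipe and every empty edge by \<open>0\<close>. Each cell then lets its two
  incoming labels pass straight or swaps them, with the weights of a solution of the Yang-Baxter
  equation in which the label \<open>0\<close> is fermionic. Pushing a crossing through two consecutive rows of
  equal type gives (b) whenever the pipes \<open>i\<close> and \<open>i + 1\<close> enter in such rows. The general case
  follows by induction on the number of rows: the top row carries the smallest or the largest number.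
  If it is not exchanged, (b) holds by linearity; if it is, the rows below it may be given the type of
  the top row, since (a), which has a unique pipe dream, and (b) for fewer rows determine their
  polynomials irrespective of the types.
\<close>

text \<open>The obstacle is that pipes \<open>i\<close> and \<open>i + 1\<close> need not enter in
  neighbouring rows: rows of the other type may lie between them, and the lowest row of each type
  also carry consecutive numbers. A crossing, however, can only be moved through neighbouring rows
  that are traversed in the same direction. The numbering makes induction possible, since the labels
  that remain after removal of the top row again form an interval. Two features of the weights carry
  the argument. Double crossings are allowed, so a weight only asks whether labels are 0; hence a
  permutation of the nonzero labels commutes with every row whose own label it fixes. And in both
  types a blank weighs \<open>A + B\<close> minus the weight of a straight tile, the types merely
  exchanging these two weights; since the direction of travel is reversed as well, the product in
  (a) cannot see the types. Dividing by the difference of two x's is replaced by cancelling it,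
  which is why the values of \<open>X\<close> are kept distinct.\<close>

section \<open>Transfer operator of a row\<close>

text \<open>The operators act on functions \<open>f\<close> of the final labels, so that composing them needs no sum over
  intermediate labels. Here \<open>c\<close> stands for \<open>A + B\<close> and \<open>a j\<close> is the weight of a straight tile.\<close>

fun row :: "'a::comm_ring_1 \<Rightarrow> (nat \<Rightarrow> 'a) \<Rightarrow> nat list \<Rightarrow> nat \<Rightarrow> (nat \<Rightarrow> nat)
    \<Rightarrow> (nat \<Rightarrow> (nat \<Rightarrow> nat) \<Rightarrow> 'a) \<Rightarrow> 'a" where
  "row c a [] h s f = f h s"
| "row c a (j # js) h s f =
     (if h = 0 \<and> s j = 0 then (c - a j) * row c a js h s f
      else a j * row c a js h s f + c * row c a js (s j) (s(j := h)) f)"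

text \<open>\<open>Q\<close> singles out the reachable pairs of horizontal and vertical labels. A
  straight tile leaves such a pair alone, so only turns have to preserve \<open>Q\<close>.\<close>

lemma row_cong_inv:
  assumes "Q h s" and "\<And>h s j. Q h s \<Longrightarrow> j \<in> set js \<Longrightarrow> Q (s j) (s(j := h))"
    and "\<And>h s. Q h s \<Longrightarrow> f h s = g h s"
  shows "row c a js h s f = row c a js h s g"
  using assms by (induction js arbitrary: h s) auto

lemma row_zero: "row c a js h s (\<lambda>_ _. 0) = 0"
  by (induction js arbitrary: h s) auto

lemma row_zero_inv:
  assumes "Q h s" and "\<And>h s j. Q h s \<Longrightarrow> j \<in> set js \<Longrightarrow> Q (s j) (s(j := h))"
    and "\<And>h s. Q h s \<Longrightarrow> f h s = 0"
  shows "row c a js h s f = 0"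
  using row_cong_inv[where g = "\<lambda>_ _. 0", OF assms] by (simp add: row_zero)

lemma row_add: "row c a js h s (\<lambda>h s. f h s + g h s) = row c a js h s f + row c a js h s g"
  by (induction js arbitrary: h s) (auto simp: algebra_simps)

lemma row_mult: "row c a js h s (\<lambda>h s. k * f h s) = k * row c a js h s f"
  by (induction js arbitrary: h s) (auto simp: algebra_simps)

text \<open>The weights only ask which labels vanish, and an injection fixing 0 does not change
  that.\<close>

lemma row_relabel:
  assumes "inj \<tau>" "\<tau> 0 = 0"
  shows "row c a js (\<tau> h) (\<lambda>j. \<tau> (s j)) f = row c a js h s (\<lambda>h s. f (\<tau> h) (\<lambda>j. \<tau> (s j)))"
proof (induction js arbitrary: h s)
  case (Cons j js)
  have z: "\<tau> x = 0 \<longleftrightarrow> x = 0" for x using assms by (metis injD)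
  have u: "(\<lambda>j. \<tau> (s j))(j := \<tau> h) = (\<lambda>i. \<tau> ((s(j := h)) i))" by auto
  show ?case by (simp only: row.simps z u Cons.IH)
qed simp

lemma row_upd:
  assumes "j \<notin> set js"
  shows "row c a js h (s(j := k)) f = row c a js h s (\<lambda>h s. f h (s(j := k)))"
  using assms by (induction js arbitrary: h s) (auto simp: fun_upd_twist)

section \<open>The Yang-Baxter equation and the exchange of two neighbouring rows\<close>

definition vertex :: "'a::comm_ring_1 \<Rightarrow> 'a \<Rightarrow> nat \<Rightarrow> nat \<Rightarrow> (nat \<Rightarrow> nat \<Rightarrow> 'a) \<Rightarrow> 'a" where
  "vertex c a h v F = (if h = 0 \<and> v = 0 then (c - a) * F h v else a * F h v + c * F v h)"

text \<open>Two equal labels weigh \<open>a + c\<close> if they are nonzero but \<open>c - a\<close>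
  if they are 0; this sign is what makes 0 fermionic. The crossing of the two horizontal lines obeys
  the same rule as a tile, with \<open>- d\<close> in place of \<open>a\<close>. As the rule depends
  on nothing but which labels vanish, eight cases remain, each a polynomial identity.\<close>

lemma yang_baxter:
  assumes "a1 - a2 = d"
  shows "vertex c (- d) p q (\<lambda>x y. vertex c a2 y v (\<lambda>k w. vertex c a1 x w (\<lambda>k' w'. F k' k w')))
       = vertex c a1 p v (\<lambda>k w. vertex c a2 q w (\<lambda>k' w'. vertex c (-d) k k' (\<lambda>x y. F x y w')))"
  unfolding assms[symmetric] vertex_def
  by (cases "p = 0"; cases "q = 0"; cases "v = 0"; simp; simp add: algebra_simps)

text \<open>The row with label \<open>h2\<close> and weights \<open>a2\<close> is the lower one.\<close>

definition two_rows :: "'a::comm_ring_1 \<Rightarrow> (nat \<Rightarrow> 'a) \<Rightarrow> (nat \<Rightarrow> 'a) \<Rightarrow> nat list \<Rightarrow> nat \<Rightarrow> nat \<Rightarrow> (nat \<Rightarrow> nat)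
    \<Rightarrow> (nat \<Rightarrow> nat \<Rightarrow> (nat \<Rightarrow> nat) \<Rightarrow> 'a) \<Rightarrow> 'a" where
  "two_rows c a1 a2 js h1 h2 s f = row c a2 js h2 s (\<lambda>k2 s. row c a1 js h1 s (\<lambda>k1 s. f k1 k2 s))"

lemma row_Cons: "row c a (j # js) h s f = vertex c (a j) h (s j) (\<lambda>k v. row c a js k (s(j := v)) f)"
  by (auto simp: vertex_def fun_upd_idem)

lemma row_vertex:
  "row c a js h s (\<lambda>k s. vertex c' b x y (\<lambda>p q. F p q k s)) = vertex c' b x y (\<lambda>p q. row c a js h s (F p q))"
  by (simp add: vertex_def row_add row_mult)

text \<open>The lower row is completed before the upper one starts, but its later tiles do not touch
  column \<open>j\<close>. The two rows may therefore be evaluated column by column, the lower tile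
  first, which is the form that \<open>yang_baxter\<close> needs.\<close>

lemma two_rows_Cons:
  assumes "j \<notin> set js"
  shows "two_rows c a1 a2 (j # js) h1 h2 s f =
    vertex c (a2 j) h2 (s j) (\<lambda>k v. vertex c (a1 j) h1 v (\<lambda>k' v'. two_rows c a1 a2 js k' k (s(j := v')) f))"
proof -
  have "row c a2 js k (s(j := v)) (\<lambda>k2 s. row c a1 (j # js) h1 s (\<lambda>k1 s. f k1 k2 s))
     = vertex c (a1 j) h1 v (\<lambda>k' v'. two_rows c a1 a2 js k' k (s(j := v')) f)" for k v
  proof -
    have "row c a2 js k (s(j := v)) (\<lambda>k2 s. row c a1 (j # js) h1 s (\<lambda>k1 s. f k1 k2 s))
      = row c a2 js k s (\<lambda>k2 s. row c a1 (j # js) h1 (s(j := v)) (\<lambda>k1 s. f k1 k2 s))"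
      by (simp add: row_upd[OF assms])
    also have "\<dots> = vertex c (a1 j) h1 v (\<lambda>k' v'. row c a2 js k s (\<lambda>k2 s. row c a1 js k' (s(j := v')) (\<lambda>k1 s. f k1 k2 s)))"
      by (simp add: row_Cons row_vertex del: row.simps)
    also have "\<dots> = vertex c (a1 j) h1 v (\<lambda>k' v'. two_rows c a1 a2 js k' k (s(j := v')) f)"
      by (simp add: two_rows_def row_upd[OF assms, of c a2 k])
    finally show ?thesis .
  qed
  then show ?thesis by (simp add: two_rows_def row_Cons del: row.simps)
qed

text \<open>The train argument: the crossing is moved from the entry side to the exit side, past one
  column at a time. It keeps its parameter because \<open>a1 j - a2 j\<close> is constant; for two
  rows of equal type the y's cancel.\<close>

lemma two_rows_intertwine:
  assumes "distinct js" and "\<And>j. j \<in> set js \<Longrightarrow> a1 j - a2 j = d"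
  shows "vertex c (- d) p q (\<lambda>h1 h2. two_rows c a1 a2 js h1 h2 s f)
       = two_rows c a2 a1 js q p s (\<lambda>k1 k2 s. vertex c (- d) k2 k1 (\<lambda>x y. f x y s))"
  using assms
proof (induction js arbitrary: p q s)
  case Nil
  then show ?case by (simp add: two_rows_def)
next
  case (Cons j js)
  have j: "j \<notin> set js" using Cons.prems by simp
  have IH: "vertex c (- d) p q (\<lambda>h1 h2. two_rows c a1 a2 js h1 h2 s f)
       = two_rows c a2 a1 js q p s (\<lambda>k1 k2 s. vertex c (- d) k2 k1 (\<lambda>x y. f x y s))" for p q s
    using Cons by simp
  have "vertex c (- d) p q (\<lambda>h1 h2. two_rows c a1 a2 (j # js) h1 h2 s f) =
     vertex c (a1 j) p (s j) (\<lambda>k w. vertex c (a2 j) q w (\<lambda>k' w'. vertex c (-d) k k'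
        (\<lambda>x y. two_rows c a1 a2 js x y (s(j := w')) f)))"
    unfolding two_rows_Cons[OF j]
    using Cons.prems by (intro yang_baxter[where F = "\<lambda>x y w'. two_rows c a1 a2 js x y (s(j := w')) f"]) simp
  also have "\<dots> = two_rows c a2 a1 (j # js) q p s (\<lambda>k1 k2 s. vertex c (- d) k2 k1 (\<lambda>x y. f x y s))"
    unfolding two_rows_Cons[OF j] IH ..
  finally show ?case .
qed

text \<open>On the exit side only two labels 0 survive, and there the crossing weighs
  \<open>c + d\<close>. On the entry side it splits into a straight and a swapped term, because
  \<open>p\<close> is nonzero.\<close>

lemma two_rows_exchange:
  assumes "distinct js" and "\<And>j. j \<in> set js \<Longrightarrow> a1 j - a2 j = d" and "p \<noteq> 0"
    and f0: "\<And>k1 k2 s. k1 \<noteq> 0 \<or> k2 \<noteq> 0 \<Longrightarrow> f k1 k2 s = 0"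
  shows "d * two_rows c a1 a2 js p q s f
    = c * two_rows c a1 a2 js q p s f - (c + d) * two_rows c a2 a1 js q p s f"
proof -
  have "vertex c (- d) k2 k1 (\<lambda>x y. f x y s) = (c + d) * f k1 k2 s" for k1 k2 s
    using f0[of k1 k2 s] f0[of k2 k1 s] by (auto simp: vertex_def fun_upd_idem)
  then have "- d * two_rows c a1 a2 js p q s f + c * two_rows c a1 a2 js q p s f
     = (c + d) * two_rows c a2 a1 js q p s f"
    using two_rows_intertwine[OF assms(1,2), where p = p and q = q and c = c and s = s and f = f] \<open>p \<noteq> 0\<close>
    by (simp add: vertex_def two_rows_def row_mult)
  then show ?thesis by (simp add: algebra_simps)
qed

section \<open>Blocks of rows\<close>

lemma row_idle:
  assumes "\<And>j. j \<in> set js \<Longrightarrow> s j = 0" "distinct js"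
  shows "row c a js 0 s f = (\<Prod>j\<in>set js. c - a j) * f 0 s"
  using assms by (induction js) (auto simp: mult_ac)

text \<open>A single configuration survives: \<open>k\<close> goes straight through
  \<open>js\<close>, turns in \<open>j0\<close>, and only blanks follow. After an earlier turn
  \<open>k\<close> stays in a column that is not visited again; without a turn in \<open>j0\<close>
  that column never receives \<open>k\<close>. All goals of \<open>I\<close> lie in
  \<open>js\<close>, so the remaining columns must have been empty from the start.\<close>

lemma row_forced:
  assumes "distinct (js @ j0 # js')" "k \<noteq> 0" "\<And>j. s j \<noteq> k" "0 \<notin> I" "\<pi> ` I \<subseteq> set js"
    and "\<And>j. s j \<noteq> 0 \<Longrightarrow> s j \<in> I" "inj_on s {j. s j \<noteq> 0}"
  shows "row c a (js @ j0 # js') k s (\<lambda>h s. if h = 0 \<and> s j0 = k \<and> (\<forall>p\<in>I. s (\<pi> p) = p) then 1 else 0)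
    = (if \<forall>p\<in>I. s (\<pi> p) = p then (\<Prod>j\<in>set js. a j) * c * (\<Prod>j\<in>set js'. c - a j) else 0)"
    (is "row c a _ k s ?f = _")
proof -
  have straight: "row c a (js1 @ j0 # js') k s ?f = (\<Prod>j\<in>set js1. a j) * row c a (j0 # js') k s ?f"
    if "set js1 \<subseteq> set js" "distinct js1" for js1
    using that
  proof (induction js1)
    case (Cons j js1)
    have "row c a (js1 @ j0 # js') (s j) (s(j := k)) ?f = 0"
    proof (rule row_zero_inv[where Q = "\<lambda>h s. h \<noteq> k \<and> (\<forall>i\<in>set (js1 @ j0 # js'). s i \<noteq> k)"])
      show "s j \<noteq> k \<and> (\<forall>i\<in>set (js1 @ j0 # js'). (s(j := k)) i \<noteq> k)"
        using Cons.prems assms(1,3) by auto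
    qed auto
    then show ?case using Cons assms(2) by (simp add: mult_ac)
  qed simp
  have 1: "row c a js' k s ?f = 0"
    by (rule row_zero_inv[where Q = "\<lambda>h s'. s' j0 = s j0"]) (use assms in auto)
  have 2: "row c a js' (s j0) (s(j0 := k)) ?f = (if \<forall>p\<in>I. s (\<pi> p) = p then \<Prod>j\<in>set js'. c - a j else 0)"
  proof (cases "\<forall>p\<in>I. s (\<pi> p) = p")
    case True
    \<comment> \<open>A nonzero label sits in its goal column, and the goal columns all belong to
      \<open>js\<close>.\<close>
    have z: "s j = 0" if "j \<notin> set js" for j
    proof (rule ccontr)
      assume j: "s j \<noteq> 0"
      then have i: "s j \<in> I" using assms by auto
      then have "s (\<pi> (s j)) = s j" using True by auto
      then have "\<pi> (s j) = j" using j assms(7) by (auto simp: inj_on_def)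
      then show False using i that assms(5) by auto
    qed
    have "row c a js' (s j0) (s(j0 := k)) ?f = row c a js' 0 (s(j0 := k)) ?f"
      using z[of j0] assms(1) by simp
    also have "\<dots> = (\<Prod>j\<in>set js'. c - a j) * ?f 0 (s(j0 := k))"
      using assms(1) by (intro row_idle) (auto intro: z)
    also have "?f 0 (s(j0 := k)) = 1" using True assms(1,5) by auto
    finally show ?thesis by (simp only: if_P[OF True] mult_1_right)
  next
    case False
    then obtain p where p: "p \<in> I" "s (\<pi> p) \<noteq> p" by blast
    then have "\<pi> p \<notin> set js'" "\<pi> p \<noteq> j0" using assms(1,5) by auto
    then have "row c a js' (s j0) (s(j0 := k)) ?f = 0"
      using p by (intro row_zero_inv[where Q = "\<lambda>h s'. s' (\<pi> p) = s (\<pi> p)"]) auto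
    then show ?thesis by (simp only: if_not_P[OF False])
  qed
  show ?thesis using straight[of js] assms(1,2) 1 2 by simp
qed

locale pipe_weights =
  fixes A B :: "'a::idom" and Y :: "nat \<Rightarrow> 'a" and n :: nat
begin

primrec columns :: "row_type \<Rightarrow> nat list" where
  "columns w_row = [1..<Suc n]"
| "columns e_row = rev [1..<Suc n]"

lemma columns_simps: "set (columns t) = {1..n}" "distinct (columns t)"
  by (cases t; auto)+

primrec straight :: "row_type \<Rightarrow> 'a \<Rightarrow> nat \<Rightarrow> 'a" where
  "straight w_row x j = A + x - Y j"
| "straight e_row x j = B - x + Y j"

definition transfer :: "(nat \<Rightarrow> 'a) \<Rightarrow> row_type \<Rightarrow> nat \<Rightarrow> ((nat \<Rightarrow> nat) \<Rightarrow> 'a) \<Rightarrow> (nat \<Rightarrow> nat) \<Rightarrow> 'a" where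
  "transfer X t k f s = row (A + B) (straight t (X k)) (columns t) k s (\<lambda>h s. if h = 0 then f s else 0)"

text \<open>The rows are listed from North to South. In the numbering of the pipes, the top row of a block
  with labels \<open>lo, lo + 1, \<dots>\<close> has the smallest label if it is of type \<^const>\<open>w_row\<close> and the largest
  one otherwise.\<close>

fun block :: "(nat \<Rightarrow> 'a) \<Rightarrow> row_type list \<Rightarrow> nat \<Rightarrow> ((nat \<Rightarrow> nat) \<Rightarrow> 'a) \<Rightarrow> 'a" where
  "block X [] lo f = f (\<lambda>_. 0)"
| "block X (w_row # bs) lo f = block X bs (Suc lo) (transfer X w_row lo f)"
| "block X (e_row # bs) lo f = block X bs lo (transfer X e_row (lo + length bs) f)"

section \<open>Reachable states and linearity in the final function\<close>

definition states :: "nat set \<Rightarrow> (nat \<Rightarrow> nat) set" where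
  "states K = {s. bij_betw s {j. s j \<noteq> 0} K \<and> {j. s j \<noteq> 0} \<subseteq> {1..n}}"

definition perms :: "nat set \<Rightarrow> (nat \<Rightarrow> nat) set" where
  "perms K = {\<pi> \<in> K \<rightarrow>\<^sub>E {1..n}. inj_on \<pi> K}"

definition target :: "nat set \<Rightarrow> (nat \<Rightarrow> nat) \<Rightarrow> (nat \<Rightarrow> nat) \<Rightarrow> 'a" where
  "target K \<pi> s = (if \<forall>p\<in>K. s (\<pi> p) = p then 1 else 0)"

lemma bij_betw_support_transpose:
  fixes s :: "nat \<Rightarrow> nat"
  assumes "bij_betw s {j. s j \<noteq> 0} K"
  shows "bij_betw (s \<circ> transpose i j) {x. (s \<circ> transpose i j) x \<noteq> 0} K"
proof (rule bij_betw_trans[OF _ assms])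
  show "bij_betw (transpose i j) {x. (s \<circ> transpose i j) x \<noteq> 0} {j. s j \<noteq> 0}"
    by (rule bij_betw_byWitness[where f' = "transpose i j"]) (auto simp: o_def)
qed

text \<open>A row that ends with horizontal label 0 has added its own label to those of the columns,
  so no other values of \<open>f\<close> are ever consulted.\<close>

lemma transfer_cong:
  assumes s: "s \<in> states K" and k: "k \<notin> K" "k \<noteq> 0"
    and fg: "\<And>s. s \<in> states (insert k K) \<Longrightarrow> f s = g s"
  shows "transfer X t k f s = transfer X t k g s"
  unfolding transfer_def
  \<comment> \<open>column \<open>0\<close> holds the horizontal label, so that a turn is a transposition of columns\<close>
proof (rule row_cong_inv[where Q = "\<lambda>h s. bij_betw (s(0 := h)) {j. (s(0 := h)) j \<noteq> 0} (insert k K)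
    \<and> {j. s j \<noteq> 0} \<subseteq> {1..n}"])
  have s': "bij_betw s {j. s j \<noteq> 0} K" "{j. s j \<noteq> 0} \<subseteq> {1..n}" using s by (auto simp: states_def)
  have "{j. (s(0 := k)) j \<noteq> 0} = insert 0 {j. s j \<noteq> 0}" using k by auto
  moreover have "bij_betw (s(0 := k)) (insert 0 {j. s j \<noteq> 0}) (insert k K)"
  proof -
    have "0 \<notin> {j. s j \<noteq> 0}" using s'(2) by auto
    moreover have "bij_betw (s(0 := k)) {j. s j \<noteq> 0} K"
      using s'(1) by (rule bij_betw_cong[THEN iffD1, rotated]) (use \<open>0 \<notin> {j. s j \<noteq> 0}\<close> in auto)
    ultimately show ?thesis using k notIn_Un_bij_betw[of 0 _ "s(0 := k)" K] by simp
  qed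
  ultimately show "bij_betw (s(0 := k)) {j. (s(0 := k)) j \<noteq> 0} (insert k K) \<and> {j. s j \<noteq> 0} \<subseteq> {1..n}"
    using s' by simp
next
  fix h s j
  assume Q: "bij_betw (s(0 := h)) {j. (s(0 := h)) j \<noteq> 0} (insert k K) \<and> {j. s j \<noteq> 0} \<subseteq> {1..n}"
    and "j \<in> set (columns t)"
  then have j: "j \<in> {1..n}" by (simp add: columns_simps)
  have "(s(j := h))(0 := s j) = s(0 := h) \<circ> transpose 0 j"
    using j by (auto simp: fun_eq_iff transpose_def)
  then show "bij_betw ((s(j := h))(0 := s j)) {ja. ((s(j := h))(0 := s j)) ja \<noteq> 0} (insert k K)
    \<and> {ja. (s(j := h)) ja \<noteq> 0} \<subseteq> {1..n}"
    using bij_betw_support_transpose[of "s(0 := h)" "insert k K" 0 j] Q j by auto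
next
  fix h s
  assume Q: "bij_betw (s(0 := h)) {j. (s(0 := h)) j \<noteq> 0} (insert k K) \<and> {j. s j \<noteq> 0} \<subseteq> {1..n}"
  have "s \<in> states (insert k K)" if "h = 0"
  proof -
    have "s 0 = 0" using Q by auto
    then have "s(0 := h) = s" using that by auto
    then show ?thesis using Q by (simp add: states_def)
  qed
  then show "(if h = 0 then f s else 0) = (if h = 0 then g s else 0)" using fg by auto
qed

lemma block_cong:
  assumes "lo \<ge> 1" and "\<And>s. s \<in> states {lo..<lo + length bs} \<Longrightarrow> f s = g s"
  shows "block X bs lo f = block X bs lo g"
  using assms
proof (induction bs arbitrary: lo f g)
  case Nil
  moreover have "(\<lambda>_. 0) \<in> states {}" by (auto simp: states_def bij_betw_def)
  ultimately show ?case by auto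
next
  case (Cons t bs)
  show ?case
  proof (cases t)
    case w_row
    have "insert lo {Suc lo..<Suc lo + length bs} = {lo..<lo + length (t # bs)}" by auto
    then have "transfer X w_row lo f s = transfer X w_row lo g s" if "s \<in> states {Suc lo..<Suc lo + length bs}" for s
      using that Cons.prems by (intro transfer_cong) auto
    then show ?thesis using Cons.prems(1) w_row by (auto intro!: Cons.IH)
  next
    case e_row
    have "insert (lo + length bs) {lo..<lo + length bs} = {lo..<lo + length (t # bs)}" by auto
    then have "transfer X e_row (lo + length bs) f s = transfer X e_row (lo + length bs) g s"
      if "s \<in> states {lo..<lo + length bs}" for s
      using that Cons.prems by (intro transfer_cong) auto
    then show ?thesis using Cons.prems(1) e_row by (auto intro!: Cons.IH)
  qed
qed

lemma transfer_add: "transfer X t k (\<lambda>s. f s + g s) s = transfer X t k f s + transfer X t k g s"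
proof -
  have "(\<lambda>h s. if h = 0 then f s + g s else 0) = (\<lambda>h s. (if h = 0 then f s else 0) + (if h = (0::nat) then g s else 0))"
    by (auto simp: fun_eq_iff)
  then show ?thesis by (simp add: transfer_def row_add)
qed

lemma transfer_mult: "transfer X t k (\<lambda>s. u * f s) s = u * transfer X t k f s"
proof -
  have "(\<lambda>h s. if h = 0 then u * f s else 0) = (\<lambda>h s. u * (if h = (0::nat) then f s else 0))"
    by (auto simp: fun_eq_iff)
  then show ?thesis by (simp add: transfer_def row_mult)
qed

lemma block_add: "block X bs lo (\<lambda>s. f s + g s) = block X bs lo f + block X bs lo g"
  by (induction X bs lo f arbitrary: g rule: block.induct) (simp_all add: transfer_add[abs_def])

lemma block_mult: "block X bs lo (\<lambda>s. u * f s) = u * block X bs lo f"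
  by (induction X bs lo f rule: block.induct) (simp_all add: transfer_mult[abs_def])

lemma block_sum: "finite I \<Longrightarrow> block X bs lo (\<lambda>s. \<Sum>i\<in>I. u i * f i s) = (\<Sum>i\<in>I. u i * block X bs lo (f i))"
proof (induction I rule: finite_induct)
  case empty
  then show ?case using block_mult[of X bs lo 0 "\<lambda>_. 0"] by simp
qed (simp add: block_add block_mult)

lemma block_cong_indets:
  assumes "\<And>k. k \<in> {lo..<lo + length bs} \<Longrightarrow> X k = X' k"
  shows "block X bs lo f = block X' bs lo f"
  using assms
proof (induction X bs lo f rule: block.induct)
  case (2 X bs lo f)
  then show ?case by (simp add: transfer_def[abs_def])
next
  case (3 X bs lo f)
  then show ?case by (simp add: transfer_def[abs_def])
qed simp

lemma transfer_relabel:
  assumes "inj \<tau>" "\<tau> 0 = 0" "\<tau> k = k"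
  shows "transfer X t k f (\<lambda>j. \<tau> (s j)) = transfer X t k (\<lambda>s. f (\<lambda>j. \<tau> (s j))) s"
proof -
  have z: "\<tau> x = 0 \<longleftrightarrow> x = 0" for x using assms by (metis injD)
  show ?thesis
    using row_relabel[OF assms(1,2), of "A + B" "straight t (X k)" "columns t" k s "\<lambda>h s. if h = 0 then f s else 0"]
    by (simp add: transfer_def assms(3) z)
qed

lemma finite_states: "finite (states K)" if "finite K"
proof (rule finite_subset)
  show "states K \<subseteq> {f. \<forall>x. (x \<in> {1..n} \<longrightarrow> f x \<in> insert 0 K) \<and> (x \<notin> {1..n} \<longrightarrow> f x = 0)}"
    by (auto simp: states_def bij_betw_def)
  show "finite {f. \<forall>x. (x \<in> {1..n} \<longrightarrow> f x \<in> insert 0 K) \<and> (x \<notin> {1..n} \<longrightarrow> f x = 0)}"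
    using that by (intro finite_set_of_finite_funs) auto
qed

text \<open>On \<open>states K\<close> every delta function is a \<open>target\<close>: the
  injection is the inverse of the labelling.\<close>

lemma target_of_state:
  assumes "s \<in> states K"
  shows "\<exists>\<pi>\<in>perms K. \<forall>s'\<in>states K. target K \<pi> s' = (if s' = s then 1 else 0)"
proof
  define S where "S = {j. s j \<noteq> 0}"
  let ?\<pi> = "restrict (inv_into S s) K"
  have bij: "bij_betw s S K" and S: "S \<subseteq> {1..n}" using assms by (auto simp: states_def S_def)
  have bij': "bij_betw (inv_into S s) K S" by (rule bij_betw_inv_into[OF bij])
  then show "?\<pi> \<in> perms K" using S by (auto simp: perms_def bij_betw_def inj_on_def)
  show "\<forall>s'\<in>states K. target K ?\<pi> s' = (if s' = s then 1 else 0)"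
  proof
    fix s' assume "s' \<in> states K"
    then have b: "bij_betw s' {j. s' j \<noteq> 0} K" by (auto simp: states_def)
    have "(\<forall>p\<in>K. s' (?\<pi> p) = p) \<longleftrightarrow> s' = s"
    proof
      assume *: "\<forall>p\<in>K. s' (?\<pi> p) = p"
      have 1: "s' j = s j" if "j \<in> S" for j
        using *[rule_format, of "s j"] that bij by (auto simp: bij_betw_def)
      \<comment> \<open>The columns of \<open>S\<close> already use up all labels of
        \<open>K\<close>, and no label occurs twice.\<close>
      have 2: "s' j = 0" if "j \<notin> S" for j
      proof (rule ccontr)
        assume nz: "s' j \<noteq> 0"
        then have "s' j \<in> K" using b by (auto simp: bij_betw_def)
        then obtain i where i: "i \<in> S" "s i = s' j" using bij by (auto simp: bij_betw_def)
        then have "s' i = s' j" using 1 by simp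
        then have "i = j" using nz b by (auto simp: bij_betw_def inj_on_def)
        then show False using that i by simp
      qed
      show "s' = s"
      proof
        show "s' j = s j" for j using 1[of j] 2[of j] by (cases "j \<in> S") (auto simp: S_def)
      qed
    next
      assume "s' = s"
      then show "\<forall>p\<in>K. s' (?\<pi> p) = p" using bij by (auto simp: bij_betw_def f_inv_into_f)
    qed
    then show "target K ?\<pi> s' = (if s' = s then 1 else 0)" by (auto simp: target_def)
  qed
qed

text \<open>Both sides are linear in \<open>f\<close> and consult it only on the finitely many
  members of \<open>states K\<close>, where \<open>f\<close> is a combination of targets.\<close>

lemma block_eqI:
  assumes "lo \<ge> 1" "length bs = length bs'" "K = {lo..<lo + length bs}"
    and "\<And>\<pi>. \<pi> \<in> perms K \<Longrightarrow> block X bs lo (target K \<pi>) = block X bs' lo (target K \<pi>)"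
  shows "block X bs lo f = block X bs' lo f"
proof -
  have fin: "finite (states K)" using assms by (intro finite_states) simp
  obtain \<pi> where \<pi>: "\<And>s. s \<in> states K \<Longrightarrow> \<pi> s \<in> perms K"
     "\<And>s s'. s \<in> states K \<Longrightarrow> s' \<in> states K \<Longrightarrow> target K (\<pi> s) s' = (if s' = s then 1 else 0)"
    using bchoice[of "states K" "\<lambda>s \<pi>. \<pi> \<in> perms K \<and> (\<forall>s'\<in>states K. target K \<pi> s' = (if s' = s then 1 else 0))"]
      target_of_state by (metis (no_types, lifting))
  have *: "block X cs lo f = (\<Sum>s\<in>states K. f s * block X cs lo (target K (\<pi> s)))"
    if "length cs = length bs" for cs
  proof -
    have "block X cs lo f = block X cs lo (\<lambda>s'. \<Sum>s\<in>states K. f s * target K (\<pi> s) s')"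
      using that assms(1,3) fin \<pi>(2)
      by (intro block_cong) (auto simp: if_distrib[of "\<lambda>x. _ * x"] cong: if_cong)
    then show ?thesis using fin by (simp add: block_sum)
  qed
  show ?thesis using *[of bs] *[of bs'] assms \<pi>(1) by simp
qed

end

section \<open>The antimonotone case and the exchange relation\<close>

context pipe_weights begin

lemma perms_transpose:
  assumes "\<pi> \<in> perms K" "i \<in> K" "j \<in> K"
  shows "\<pi> \<circ> transpose i j \<in> perms K"
proof -
  have "bij_betw (transpose i j) K K" using assms by (intro bij_betw_byWitness[where f' = "transpose i j"])
      (auto simp: transpose_def)
  moreover from this have "inj_on (\<pi> \<circ> transpose i j) K"
    using assms(1) by (intro comp_inj_on) (auto simp: perms_def bij_betw_def)
  moreover have "(\<pi> \<circ> transpose i j) x = undefined" if "x \<notin> K" for x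
    using that assms by (auto simp: transpose_def perms_def PiE_def extensional_def)
  moreover have "(\<pi> \<circ> transpose i j) x \<in> {1..n}" if "x \<in> K" for x
  proof -
    have "transpose i j x \<in> K" using that assms by (auto simp: transpose_def)
    then show ?thesis using assms(1) by (auto simp: perms_def)
  qed
  ultimately show ?thesis by (auto simp: perms_def)
qed

text \<open>Removing an ascent at neighbouring places lowers the sum of all
  \<open>p * \<pi> p\<close>, and without such ascents the injection is decreasing. The same
  induction shows that the row types do not matter and, at the end, that (a) and (b) determine the
  family.\<close>

lemma perms_induct [consumes 1, case_names antimono exchange]:
  assumes "\<pi> \<in> perms {lo..<hi}"
    and antimono: "\<And>\<pi>. \<pi> \<in> perms {lo..<hi} \<Longrightarrow> strict_antimono_on {lo..<hi} \<pi> \<Longrightarrow> P \<pi>"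
    and exchange: "\<And>\<pi> i. \<pi> \<in> perms {lo..<hi} \<Longrightarrow> lo \<le> i \<Longrightarrow> Suc i < hi \<Longrightarrow> P (\<pi> \<circ> transpose i (Suc i)) \<Longrightarrow> P \<pi>"
  shows "P \<pi>"
  using assms(1)
proof (induction "\<Sum>p\<in>{lo..<hi}. p * \<pi> p" arbitrary: \<pi> rule: less_induct)
  case less
  show ?case
  proof (cases "\<forall>i. lo \<le> i \<and> Suc i < hi \<longrightarrow> \<pi> (Suc i) < \<pi> i")
    case True
    have "strict_antimono_on {lo..<hi} \<pi>"
    proof (rule monotone_onI)
      fix x y assume "x \<in> {lo..<hi}" "y \<in> {lo..<hi}" "x < y"
      then show "\<pi> y < \<pi> x"
      proof (induction y)
        case (Suc y)
        then have "\<pi> (Suc y) < \<pi> y" using True by auto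
        then show ?case using Suc by (cases "x = y") auto
      qed simp
    qed
    then show ?thesis using antimono less.prems by blast
  next
    case False
    then obtain i where i: "lo \<le> i" "Suc i < hi" "\<pi> i \<le> \<pi> (Suc i)" by force
    have "\<pi> i \<noteq> \<pi> (Suc i)" 
      using less.prems i inj_on_eq_iff[of \<pi> "{lo..<hi}" i "Suc i"] by (auto simp: perms_def)
    with i have lt: "\<pi> i < \<pi> (Suc i)" by simp
    define K where "K = {lo..<hi} - {i, Suc i}"
    have K: "{lo..<hi} = insert i (insert (Suc i) K)" "i \<notin> K" "Suc i \<notin> K" "finite K" using i by (auto simp: K_def)
    have eq: "(\<Sum>p\<in>K. p * (\<pi> \<circ> transpose i (Suc i)) p) = (\<Sum>p\<in>K. p * \<pi> p)"
      using K by (intro sum.cong) (auto simp: transpose_def)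
    have "(\<Sum>p\<in>{lo..<hi}. p * (\<pi> \<circ> transpose i (Suc i)) p) < (\<Sum>p\<in>{lo..<hi}. p * \<pi> p)"
      unfolding K(1) using K(2-4) eq lt by simp
    moreover have "\<pi> \<circ> transpose i (Suc i) \<in> perms {lo..<hi}" using less.prems i by (intro perms_transpose) auto
    ultimately show ?thesis using less exchange i by blast
  qed
qed

lemma target_transpose:
  assumes "i \<in> K" "j \<in> K"
  shows "target K \<pi> (\<lambda>x. transpose i j (s x)) = target K (\<pi> \<circ> transpose i j) s"
proof -
  have "(\<forall>p\<in>K. transpose i j (s (\<pi> p)) = p) \<longleftrightarrow> (\<forall>p\<in>K. s (\<pi> (transpose i j p)) = p)"
  proof -
    have "(\<forall>p\<in>K. transpose i j (s (\<pi> p)) = p) \<longleftrightarrow> (\<forall>p\<in>transpose i j ` K. transpose i j (s (\<pi> p)) = p)"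
      using assms by simp
    also have "\<dots> \<longleftrightarrow> (\<forall>p\<in>K. s (\<pi> (transpose i j p)) = p)"
      by (auto simp: transpose_eq_iff)
    finally show ?thesis .
  qed
  then show ?thesis by (simp add: target_def)
qed

definition antimono_product :: "(nat \<Rightarrow> 'a) \<Rightarrow> nat set \<Rightarrow> (nat \<Rightarrow> nat) \<Rightarrow> 'a" where
  "antimono_product X K \<pi> = (\<Prod>i\<in>K. (A + B) * (\<Prod>j\<in>{1..<\<pi> i}. A + X i - Y j) * (\<Prod>j\<in>{\<pi> i<..n}. B - X i + Y j))"

text \<open>A top row of type \<open>w_row\<close> has the smallest label, which a decreasing
  injection sends furthest East; so the other goals come earlier in the direction of travel, and
  \<open>row_forced\<close> applies. Type \<open>e_row\<close> is the mirror image: largest label,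
  furthest West. Mirroring exchanges straight cells with blank ones and also their weights, which is
  why \<open>t\<close> has disappeared from the right-hand side.\<close>

lemma transfer_target_antimono:
  assumes s: "s \<in> states K" and k: "k \<noteq> 0" "k \<notin> K" and \<pi>: "\<pi> \<in> perms (insert k K)"
    and side: "\<And>p. p \<in> K \<Longrightarrow> if t = w_row then \<pi> p < \<pi> k else \<pi> k < \<pi> p"
  shows "transfer X t k (target (insert k K) \<pi>) s =
    (A + B) * (\<Prod>j\<in>{1..<\<pi> k}. A + X k - Y j) * (\<Prod>j\<in>{\<pi> k<..n}. B - X k + Y j) * target K \<pi> s"
proof -
  define l where "l = [1..<\<pi> k]"
  define r where "r = [Suc (\<pi> k)..<Suc n]"
  define before where "before = (if t = w_row then l else rev r)"
  define after where "after = (if t = w_row then r else rev l)"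
  have \<pi>k: "1 \<le> \<pi> k" "\<pi> k \<le> n" using \<pi> by (auto simp: perms_def)
  have cat: "[1..<Suc n] = l @ \<pi> k # r"
  proof -
    have "[1..<Suc n] = [1..<\<pi> k] @ [\<pi> k..<Suc n]" using \<pi>k upt_add_eq_append[of 1 "\<pi> k" "Suc n - \<pi> k"] by simp
    also have "[\<pi> k..<Suc n] = \<pi> k # r" unfolding r_def using \<pi>k by (intro upt_conv_Cons) simp
    finally show ?thesis by (simp add: l_def)
  qed
  have cols: "columns t = before @ \<pi> k # after"
    using cat by (cases t) (simp_all add: before_def after_def)
  have fn: "(\<lambda>h s. if h = 0 then target (insert k K) \<pi> s else 0) =
     (\<lambda>h s. if h = 0 \<and> s (\<pi> k) = k \<and> (\<forall>p\<in>K. s (\<pi> p) = p) then 1 else 0)"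
    by (auto simp: target_def fun_eq_iff)
  have "transfer X t k (target (insert k K) \<pi>) s = (if \<forall>p\<in>K. s (\<pi> p) = p
     then (\<Prod>j\<in>set before. straight t (X k) j) * (A + B) * (\<Prod>j\<in>set after. A + B - straight t (X k) j) else 0)"
    unfolding transfer_def cols fn
  proof (rule row_forced)
    show "distinct (before @ \<pi> k # after)" using columns_simps(2)[of t] cols by simp
    show "0 \<notin> K" "inj_on s {j. s j \<noteq> 0}" using s by (auto simp: states_def bij_betw_def)
    show "s j \<in> K" if "s j \<noteq> 0" for j using s that by (auto simp: states_def bij_betw_def)
    then show "s j \<noteq> k" for j using k by metis
    show "\<pi> ` K \<subseteq> set before"
    proof (rule image_subsetI)
      fix p assume "p \<in> K"
      moreover from this have "\<pi> p \<in> {1..n}" using \<pi> by (auto simp: perms_def)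
      ultimately show "\<pi> p \<in> set before" using side[of p] by (cases t) (auto simp: before_def l_def r_def)
    qed
  qed (use k in auto)
  also have "\<dots> = (A + B) * (\<Prod>j\<in>set l. A + X k - Y j) * (\<Prod>j\<in>set r. B - X k + Y j) * target K \<pi> s"
    by (cases t) (auto simp: target_def before_def after_def algebra_simps)
  also have "set l = {1..<\<pi> k}" by (simp add: l_def)
  also have "set r = {\<pi> k<..n}" by (auto simp: r_def)
  finally show ?thesis .
qed

lemma perms_mono: "\<pi> \<in> perms K \<Longrightarrow> K' \<subseteq> K \<Longrightarrow> restrict \<pi> K' \<in> perms K'"
  by (auto simp: perms_def inj_on_def)

lemma target_restrict: "target K (restrict \<pi> K) = target K \<pi>"
  by (auto simp: target_def fun_eq_iff)

lemma block_antimono: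
  assumes "lo \<ge> 1" "\<pi> \<in> perms {lo..<lo + length bs}" "strict_antimono_on {lo..<lo + length bs} \<pi>"
  shows "block X bs lo (target {lo..<lo + length bs} \<pi>) = antimono_product X {lo..<lo + length bs} \<pi>"
  using assms
proof (induction bs arbitrary: lo \<pi>)
  case Nil
  then show ?case by (simp add: target_def antimono_product_def)
next
  case (Cons t bs)
  define K where "K = {lo..<lo + length (t # bs)}"
  define lo' where "lo' = (if t = w_row then Suc lo else lo)"
  define k where "k = (if t = w_row then lo else lo + length bs)"
  define K' where "K' = {lo'..<lo' + length bs}"
  have K: "K = insert k K'" "k \<notin> K'" "finite K'" "k \<noteq> 0" "lo' \<ge> 1"
    using Cons.prems(1) by (auto simp: K_def K'_def lo'_def k_def)
  have anti: "strict_antimono_on K \<pi>" and \<pi>: "\<pi> \<in> perms K" using Cons.prems by (simp_all add: K_def)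
  have side: "if t = w_row then \<pi> p < \<pi> k else \<pi> k < \<pi> p" if "p \<in> K'" for p
  proof -
    have "p \<in> K" "k \<in> K" "if t = w_row then k < p else p < k"
      using that K by (auto simp: K'_def lo'_def k_def)
    then show ?thesis using anti by (auto simp: monotone_on_def split: if_splits)
  qed
  have blk: "block X (t # bs) lo f = block X bs lo' (transfer X t k f)" for f
    by (cases t) (simp_all add: lo'_def k_def)
  let ?c = "(A + B) * (\<Prod>j\<in>{1..<\<pi> k}. A + X k - Y j) * (\<Prod>j\<in>{\<pi> k<..n}. B - X k + Y j)"
  have "block X (t # bs) lo (target K \<pi>) = block X bs lo' (\<lambda>s. ?c * target K' \<pi> s)"
    unfolding blk K(1)
  proof (rule block_cong[OF K(5)])
    fix s assume "s \<in> states {lo'..<lo' + length bs}"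
    then show "transfer X t k (target (insert k K') \<pi>) s = ?c * target K' \<pi> s"
      using K(2,4) \<pi> side unfolding K(1) by (intro transfer_target_antimono) (simp_all add: K'_def)
  qed
  also have "\<dots> = ?c * block X bs lo' (target K' (restrict \<pi> K'))"
    by (simp add: block_mult target_restrict)
  also have "block X bs lo' (target K' (restrict \<pi> K')) = antimono_product X K' (restrict \<pi> K')"
    unfolding K'_def
  proof (rule Cons.IH[OF K(5)], fold K'_def)
    show "restrict \<pi> K' \<in> perms K'" using \<pi> K(1) by (auto intro: perms_mono)
    show "strict_antimono_on K' (restrict \<pi> K')" using anti K(1) by (auto simp: monotone_on_def)
  qed
  also have "\<dots> = antimono_product X K' \<pi>" by (simp add: antimono_product_def)
  also have "?c * \<dots> = antimono_product X K \<pi>"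
    unfolding K(1) using K by (simp add: antimono_product_def)
  finally show ?case by (simp add: K_def)
qed

text \<open>In \<open>two_rows_exchange\<close> the entering labels are interchanged. As the columns
  contain neither \<open>p\<close> nor \<open>q\<close>, relabelling by \<open>\<tau>\<close>
  restores the order of entry at the price of permuting the final labels inside \<open>f\<close>;
  the interchanged weights become \<open>X \<circ> \<tau>\<close>.\<close>

lemma transfer_exchange:
  assumes pq: "p \<noteq> 0" "q \<noteq> 0" and s: "\<And>j. s j \<noteq> p" "\<And>j. s j \<noteq> q"
    and d: "\<And>j. straight t (X p) j - straight t (X q) j = d"
  defines "\<tau> \<equiv> transpose p q"
  shows "d * transfer X t q (transfer X t p f) s =
    (A + B) * transfer X t q (transfer X t p (\<lambda>s. f (\<lambda>j. \<tau> (s j)))) s -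
    (A + B + d) * transfer (X \<circ> \<tau>) t q (transfer (X \<circ> \<tau>) t p (\<lambda>s. f (\<lambda>j. \<tau> (s j)))) s"
proof -
  define F where "F f = (\<lambda>k1 k2 s. if k1 = (0::nat) \<and> k2 = (0::nat) then f s else (0::'a))" for f :: "(nat \<Rightarrow> nat) \<Rightarrow> 'a"
  define a where "a = straight t (X p)"
  define b where "b = straight t (X q)"
  have two: "transfer Z t q (transfer Z t p f) s
     = two_rows (A + B) (straight t (Z p)) (straight t (Z q)) (columns t) p q s (F f)" for Z f
    unfolding transfer_def two_rows_def F_def
    by (rule arg_cong[where f = "row _ _ _ _ _"]) (auto simp: fun_eq_iff row_zero)
  have \<tau>0: "\<tau> 0 = 0" "inj \<tau>" "\<tau> p = q" "\<tau> q = p" using pq by (auto simp: \<tau>_def)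
  have z: "\<tau> x = 0 \<longleftrightarrow> x = 0" for x using \<tau>0(1,2) by (metis injD)
  have \<tau>s: "(\<lambda>j. \<tau> (s j)) = s" using s by (auto simp: fun_eq_iff \<tau>_def transpose_def)
  have relabel: "two_rows (A + B) a' b' js q p s (F f) =
      two_rows (A + B) a' b' js p q s (F (\<lambda>s. f (\<lambda>j. \<tau> (s j))))" for a' b' js
  proof -
    have "two_rows (A + B) a' b' js q p s (F f) =
      row (A + B) b' js (\<tau> q) (\<lambda>j. \<tau> (s j)) (\<lambda>k2 s. row (A + B) a' js (\<tau> p) s (\<lambda>k1 s. F f k1 k2 s))"
      unfolding two_rows_def \<tau>0 \<tau>s ..
    also have "\<dots> = row (A + B) b' js q s (\<lambda>k2 s. row (A + B) a' js (\<tau> p) (\<lambda>j. \<tau> (s j)) (\<lambda>k1 s. F f k1 (\<tau> k2) s))"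
      by (rule row_relabel[OF \<tau>0(2,1)])
    also have "\<dots> = row (A + B) b' js q s (\<lambda>k2 s. row (A + B) a' js p s (\<lambda>k1 s. F f (\<tau> k1) (\<tau> k2) (\<lambda>j. \<tau> (s j))))"
      by (simp only: row_relabel[OF \<tau>0(2,1)])
    finally show ?thesis by (simp add: two_rows_def F_def z)
  qed
  have "d * two_rows (A + B) a b (columns t) p q s (F f)
    = (A + B) * two_rows (A + B) a b (columns t) q p s (F f) - (A + B + d) * two_rows (A + B) b a (columns t) q p s (F f)"
    by (rule two_rows_exchange) (use d pq in \<open>auto simp: columns_simps a_def b_def F_def\<close>)
  then show ?thesis unfolding relabel two by (simp add: a_def b_def \<tau>0)
qed

text \<open>Relation (b) with its denominator cleared, in the generality required by the induction:
  \<open>f\<close> absorbs rows removed at the top, and \<open>X\<close> is arbitrary so that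
  exchanging two of its values expresses \<open>r_i\<close>. Injectivity of \<open>X\<close> lets
  the left factor be cancelled.\<close>

definition exchanges :: "nat \<Rightarrow> bool" where
  "exchanges m \<longleftrightarrow> (\<forall>bs lo i X f. length bs = m \<longrightarrow> 1 \<le> lo \<longrightarrow> inj X \<longrightarrow> lo \<le> i \<longrightarrow> Suc i < lo + m \<longrightarrow>
     (X i - X (Suc i)) * block X bs lo f =
       (A + B) * block X bs lo (\<lambda>s. f (\<lambda>j. transpose i (Suc i) (s j)))
       - (A + B + (X i - X (Suc i))) * block (X \<circ> transpose i (Suc i)) bs lo (\<lambda>s. f (\<lambda>j. transpose i (Suc i) (s j))))"

text \<open>Both blocks obey the same recursion and have the same values on decreasing injections.
  \<open>X\<close> varies in the induction because the last term of the recursion permutes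
  it.\<close>

lemma block_type_independent:
  assumes ex: "exchanges (length bs)" and len: "length bs = length bs'" and "inj X" "1 \<le> lo"
  shows "block X bs lo f = block X bs' lo f"
proof (rule block_eqI[OF \<open>1 \<le> lo\<close> len refl])
  let ?K = "{lo..<lo + length bs}"
  fix \<pi> assume "\<pi> \<in> perms ?K"
  then show "block X bs lo (target ?K \<pi>) = block X bs' lo (target ?K \<pi>)"
    using \<open>inj X\<close>
  proof (induction arbitrary: X rule: perms_induct)
    case (antimono \<pi>)
    then show ?case using block_antimono[of lo \<pi> bs X] block_antimono[of lo \<pi> bs' X] len \<open>1 \<le> lo\<close> by simp
  next
    case (exchange \<pi> i)
    have inj': "inj (X \<circ> transpose i (Suc i))" using exchange.prems by (simp add: inj_compose)
    have tgt: "(\<lambda>s. target ?K \<pi> (\<lambda>j. transpose i (Suc i) (s j))) = target ?K (\<pi> \<circ> transpose i (Suc i))"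
      using exchange by (intro ext target_transpose) auto
    have *: "(X i - X (Suc i)) * block X cs lo (target ?K \<pi>) =
       (A + B) * block X cs lo (target ?K (\<pi> \<circ> transpose i (Suc i)))
       - (A + B + (X i - X (Suc i))) * block (X \<circ> transpose i (Suc i)) cs lo (target ?K (\<pi> \<circ> transpose i (Suc i)))"
      if "length cs = length bs" for cs
      using ex[unfolded exchanges_def, rule_format, of cs lo X i "target ?K \<pi>"] that exchange \<open>1 \<le> lo\<close>
      unfolding tgt by simp
    have "(X i - X (Suc i)) * block X bs lo (target ?K \<pi>) = (X i - X (Suc i)) * block X bs' lo (target ?K \<pi>)"
      unfolding *[OF refl] *[OF len[symmetric]] exchange.IH[OF exchange.prems] exchange.IH[OF inj'] ..
    moreover have "X i - X (Suc i) \<noteq> 0" using exchange.prems by (auto simp: inj_eq)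
    ultimately show ?case by simp
  qed
qed

text \<open>When \<open>r\<^sub>i\<close> moves the label of the top row, independence of the row types allows the next row to be
  given the type of the top one, so only equal types have to be exchanged.\<close>

lemma exchanges: "exchanges m"
proof (induction m)
  case 0
  then show ?case by (simp add: exchanges_def)
next
  case (Suc m)
  show ?case unfolding exchanges_def
  proof (intro allI impI)
    fix bs0 :: "row_type list" and lo i and X :: "nat \<Rightarrow> 'a" and f :: "(nat \<Rightarrow> nat) \<Rightarrow> 'a"
    assume len0: "length bs0 = Suc m" and lo: "1 \<le> lo" and X: "inj X" and i: "lo \<le> i" "Suc i < lo + Suc m"
    define \<tau> where "\<tau> = transpose i (Suc i)"
    define D where "D = X i - X (Suc i)"
    have X': "inj (X \<circ> \<tau>)" using X by (simp add: inj_compose \<tau>_def)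
    have \<tau>: "inj \<tau>" "\<tau> 0 = 0" using lo i by (auto simp: \<tau>_def)
    obtain t :: row_type and bs where bs0: "bs0 = t # bs" and len: "length bs = m" using len0 by (cases bs0) auto
    define lo' where "lo' = (if t = w_row then Suc lo else lo)"
    define k where "k = (if t = w_row then lo else lo + length bs)"
    have blk: "block Z (t # cs) lo g = block Z cs lo' (transfer Z t k g)" if "length cs = length bs" for Z cs g
      using that by (cases t) (simp_all add: lo'_def k_def)
    let ?f = "\<lambda>s. f (\<lambda>j. \<tau> (s j))"
    have "D * block X bs0 lo f = (A + B) * block X bs0 lo ?f - (A + B + D) * block (X \<circ> \<tau>) bs0 lo ?f"
    proof (cases "i = k \<or> Suc i = k")
      \<comment> \<open>The top row has neither of the two labels, so \<open>\<tau>\<close> passes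
        through it and the row becomes part of the final function in the induction
        hypothesis.\<close>
      case False
      then have range: "lo' \<le> i" "Suc i < lo' + length bs" and \<tau>k: "\<tau> k = k"
        using i len by (auto simp: lo'_def k_def \<tau>_def transpose_def split: if_splits)
      have rel: "transfer X t k f (\<lambda>j. \<tau> (s j)) = transfer X t k ?f s" for s
        by (rule transfer_relabel[OF \<tau> \<tau>k])
      have ind: "transfer (X \<circ> \<tau>) t k ?f = transfer X t k ?f"
        by (simp add: transfer_def[abs_def] \<tau>k)
      show ?thesis
        using Suc[unfolded exchanges_def, rule_format, of bs lo' X i "transfer X t k f"] len lo X range
        unfolding bs0 blk[OF refl] ind \<tau>_def[symmetric] D_def[symmetric] rel by (simp add: lo'_def)
    next
      case True
      \<comment> \<open>Only the length of \<open>cs\<close> matters; its types may be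
        anything.\<close>
      then obtain cs :: "row_type list" where "length bs = Suc (length cs)" using i len by (cases bs) (auto simp: k_def split: if_splits)
      define q where "q = (if t = w_row then Suc i else i)"
      define lo'' where "lo'' = (if t = w_row then Suc (Suc lo) else lo)"
      have kq: "k = (if t = w_row then i else Suc i)" using True i len by (auto simp: k_def split: if_splits)
      have blk': "block Z (t # bs) lo g = block X cs lo'' (transfer Z t q (transfer Z t k g))"
        if "Z = X \<or> Z = X \<circ> \<tau>" for Z g
      proof -
        have "block Z (t # bs) lo g = block Z (t # cs) lo' (transfer Z t k g)"
          unfolding blk[OF refl] using X X' that Suc lo len \<open>length bs = Suc (length cs)\<close>
          by (intro block_type_independent) (auto simp: lo'_def)
        also have "\<dots> = block Z cs lo'' (transfer Z t q (transfer Z t k g))"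
          using kq \<open>length bs = Suc (length cs)\<close> by (cases t) (simp_all add: lo'_def lo''_def q_def k_def)
        \<comment> \<open>The labels of \<open>cs\<close> avoid \<open>i\<close> and
          \<open>Suc i\<close>, so below the two exchanged rows \<open>X\<close> and
          \<open>X \<circ> \<tau>\<close> agree.\<close>
        also have "\<dots> = block X cs lo'' (transfer Z t q (transfer Z t k g))"
          using that kq \<open>length bs = Suc (length cs)\<close>
          by (intro block_cong_indets) (auto simp: lo''_def \<tau>_def transpose_def k_def split: if_splits)
        finally show ?thesis .
      qed
      have "D * block X bs0 lo f = block X cs lo'' (\<lambda>s. D * transfer X t q (transfer X t k f) s)"
        by (simp add: bs0 blk' block_mult)
      also have "\<dots> = block X cs lo'' (\<lambda>s. (A + B) * transfer X t q (transfer X t k ?f) s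
          + (- (A + B + D)) * transfer (X \<circ> \<tau>) t q (transfer (X \<circ> \<tau>) t k ?f) s)"
      proof (rule block_cong)
        fix s assume "s \<in> states {lo''..<lo'' + length cs}"
        then have s: "s j \<noteq> 0 \<Longrightarrow> s j \<in> {lo''..<lo'' + length cs}" for j by (auto simp: states_def bij_betw_def)
        have "q \<noteq> 0" "k \<noteq> 0" "q \<notin> {lo''..<lo'' + length cs}" "k \<notin> {lo''..<lo'' + length cs}"
          using kq lo i \<open>length bs = Suc (length cs)\<close> by (auto simp: q_def lo''_def k_def split: if_splits)
        moreover from this have "s j \<noteq> q" "s j \<noteq> k" for j using s[of j] by metis+
        \<comment> \<open>The type decides both the sign of the x in \<open>straight\<close> and
          which of \<open>k\<close>, \<open>q\<close> is larger; the two signs cancel.\<close>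
        moreover have "straight t (X k) j - straight t (X q) j = D" for j
          by (cases t) (simp_all add: kq q_def D_def)
        moreover have "transpose k q = \<tau>" by (auto simp: kq q_def \<tau>_def transpose_commute)
        ultimately show "D * transfer X t q (transfer X t k f) s = (A + B) * transfer X t q (transfer X t k ?f) s
          + (- (A + B + D)) * transfer (X \<circ> \<tau>) t q (transfer (X \<circ> \<tau>) t k ?f) s"
          using transfer_exchange[of k q s t X D f] by (simp add: algebra_simps)
      qed (use lo in \<open>simp add: lo''_def\<close>)
      also have "\<dots> = (A + B) * block X bs0 lo ?f - (A + B + D) * block (X \<circ> \<tau>) bs0 lo ?f"
        unfolding bs0 blk'[OF disjI1[OF refl]] blk'[OF disjI2[OF refl]] block_add block_mult by (simp add: algebra_simps)
      finally show ?thesis .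
    qed
    then show "(X i - X (Suc i)) * block X bs0 lo f =
       (A + B) * block X bs0 lo (\<lambda>s. f (\<lambda>j. transpose i (Suc i) (s j)))
       - (A + B + (X i - X (Suc i))) * block (X \<circ> transpose i (Suc i)) bs0 lo (\<lambda>s. f (\<lambda>j. transpose i (Suc i) (s j)))"
      unfolding D_def \<tau>_def .
  qed
qed

end

section \<open>Sums over fillings\<close>

primrec inside :: "row_type \<Rightarrow> side" where
  "inside w_row = West"
| "inside e_row = East"

primrec outside :: "row_type \<Rightarrow> side" where
  "outside w_row = East"
| "outside e_row = West"

definition straight_tile :: "bool \<Rightarrow> bool \<Rightarrow> tile" where
  "straight_tile h v = (if h then {{West, East}} else {}) \<union> (if v then {{South, North}} else {})"

definition elbow_tile :: "row_type \<Rightarrow> bool \<Rightarrow> bool \<Rightarrow> tile" where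
  "elbow_tile t h v = (if h then {{inside t, North}} else {}) \<union> (if v then {{South, outside t}} else {})"

lemma tiles_eq: "tiles t = {straight_tile h v | h v. True} \<union> {elbow_tile t h v | h v. True}"
proof -
  have ex: "{F h v | h v. True} = {F False False, F False True, F True False, F True True}" for F :: "bool \<Rightarrow> bool \<Rightarrow> tile"
    by (simp only: ex_bool_eq simp_thms set_eq_iff mem_Collect_eq insert_iff empty_iff) blast
  show ?thesis unfolding ex
    by (cases t) (auto simp: tiles_def straight_tiles_def blank_def straight_tile_def elbow_tile_def)
qed

lemma side_sets [simp]:
  "West \<in> \<Union>(straight_tile h v) \<longleftrightarrow> h" "East \<in> \<Union>(straight_tile h v) \<longleftrightarrow> h"
  "North \<in> \<Union>(straight_tile h v) \<longleftrightarrow> v" "South \<in> \<Union>(straight_tile h v) \<longleftrightarrow> v"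
  "inside t \<in> \<Union>(straight_tile h v) \<longleftrightarrow> h" "outside t \<in> \<Union>(straight_tile h v) \<longleftrightarrow> h"
  "inside t \<in> \<Union>(elbow_tile t h v) \<longleftrightarrow> h" "outside t \<in> \<Union>(elbow_tile t h v) \<longleftrightarrow> v"
  "North \<in> \<Union>(elbow_tile t h v) \<longleftrightarrow> h" "South \<in> \<Union>(elbow_tile t h v) \<longleftrightarrow> v"
  by (cases t; auto simp: straight_tile_def elbow_tile_def)+

lemma straight_tile_elbow [simp]: "straight_tile h v \<notin> elbow_tiles t"
  by (cases t; cases h; cases v; auto simp: straight_tile_def doubleton_eq_iff)

lemma elbow_tile_elbow [simp]: "elbow_tile t h v \<in> elbow_tiles t \<longleftrightarrow> h \<or> v"
  by (cases t; cases h; cases v; auto simp: elbow_tile_def doubleton_eq_iff)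

lemma tile_blank [simp]: "straight_tile h v = blank \<longleftrightarrow> \<not> h \<and> \<not> v" "elbow_tile t h v = blank \<longleftrightarrow> \<not> h \<and> \<not> v"
  "elbow_tile t False False = blank" "straight_tile False False = blank"
  by (auto simp: straight_tile_def elbow_tile_def blank_def)

lemma blank_not_elbow [simp]: "blank \<notin> elbow_tiles t"
  by (cases t) (auto simp: blank_def)

text \<open>Two occupied or empty incoming edges leave one straight and one elbow tile. If both
  edges are empty, the two coincide with the blank, which explains the single term in that case of
  \<open>row\<close>.\<close>

lemma matching_tiles:
  "{T \<in> tiles t. (inside t \<in> \<Union>T \<longleftrightarrow> h) \<and> (South \<in> \<Union>T \<longleftrightarrow> v)} = {straight_tile h v, elbow_tile t h v}"
proof (intro set_eqI iffI)
  fix T assume "T \<in> {T \<in> tiles t. (inside t \<in> \<Union>T \<longleftrightarrow> h) \<and> (South \<in> \<Union>T \<longleftrightarrow> v)}"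
  then have *: "inside t \<in> \<Union>T \<longleftrightarrow> h" "South \<in> \<Union>T \<longleftrightarrow> v" and "T \<in> tiles t" by blast+
  then obtain h' v' where "T = straight_tile h' v' \<or> T = elbow_tile t h' v'" unfolding tiles_eq by blast
  then show "T \<in> {straight_tile h v, elbow_tile t h v}"
    using * by (elim disjE) (simp_all only: side_sets insert_iff simp_thms)
next
  fix T assume "T \<in> {straight_tile h v, elbow_tile t h v}"
  then consider "T = straight_tile h v" | "T = elbow_tile t h v" by blast
  then show "T \<in> {T \<in> tiles t. (inside t \<in> \<Union>T \<longleftrightarrow> h) \<and> (South \<in> \<Union>T \<longleftrightarrow> v)}"
    by cases (simp only: tiles_eq mem_Collect_eq Un_iff side_sets simp_thms, blast)+
qed

lemma tile_cases:
  assumes "T \<in> tiles t"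
  obtains h v where "T = straight_tile h v" | h v where "T = elbow_tile t h v" "h \<or> v"
proof -
  obtain h v where "T = straight_tile h v \<or> T = elbow_tile t h v" using assms unfolding tiles_eq by blast
  then show ?thesis
    using that(1)[of h v] that(1)[of False False] that(2)[of h v] by (cases "h \<or> v") auto
qed

fun cell_sum :: "'a::comm_ring_1 \<Rightarrow> (nat \<times> nat \<Rightarrow> 'a) \<Rightarrow> (nat \<times> nat) list \<Rightarrow> (nat \<Rightarrow> nat) \<Rightarrow> (nat \<Rightarrow> nat)
    \<Rightarrow> ((nat \<Rightarrow> nat) \<Rightarrow> (nat \<Rightarrow> nat) \<Rightarrow> 'a) \<Rightarrow> 'a" where
  "cell_sum c a [] hs vs f = f hs vs"
| "cell_sum c a ((i, j) # cs) hs vs f =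
     (if hs i = 0 \<and> vs j = 0 then (c - a (i, j)) * cell_sum c a cs hs vs f
      else a (i, j) * cell_sum c a cs hs vs f + c * cell_sum c a cs (hs(i := vs j)) (vs(j := hs i)) f)"

lemma cell_sum_row:
  "cell_sum c a (map (Pair i) js @ cs) hs vs f =
    row c (\<lambda>j. a (i, j)) js (hs i) vs (\<lambda>h s. cell_sum c a cs (hs(i := h)) s f)"
  by (induction js arbitrary: hs vs) auto

text \<open>Row \<open>i\<close> is not visited again, so its nonzero label persists until
  \<open>f\<close> is evaluated.\<close>

lemma cell_sum_zero:
  assumes "i \<notin> fst ` set cs" "hs i \<noteq> 0" "\<And>hs vs. hs i \<noteq> 0 \<Longrightarrow> f hs vs = 0"
  shows "cell_sum c a cs hs vs f = 0"
  using assms(1,2)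
proof (induction cs arbitrary: hs vs)
  case (Cons x cs)
  then show ?case by (cases x) auto
qed (simp add: assms(3))

fun run :: "(nat \<times> nat \<Rightarrow> bool) \<Rightarrow> (nat \<times> nat) list \<Rightarrow> (nat \<Rightarrow> nat) \<Rightarrow> (nat \<Rightarrow> nat)
    \<Rightarrow> (nat \<Rightarrow> nat) \<times> (nat \<Rightarrow> nat)" where
  "run E [] hs vs = (hs, vs)"
| "run E ((i, j) # cs) hs vs = (if E (i, j) then run E cs (hs(i := vs j)) (vs(j := hs i)) else run E cs hs vs)"

definition elbow_at :: "(nat \<Rightarrow> row_type) \<Rightarrow> filling \<Rightarrow> nat \<times> nat \<Rightarrow> bool" where
  "elbow_at \<beta> P c \<longleftrightarrow> P c \<in> elbow_tiles (\<beta> (fst c))"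

text \<open>Only the two incoming edges of each cell are tested, since the tile then determines its
  outgoing ones. A blank is not an elbow and is treated as a straight tile.\<close>

fun fits :: "(nat \<Rightarrow> row_type) \<Rightarrow> filling \<Rightarrow> (nat \<times> nat) list \<Rightarrow> (nat \<Rightarrow> nat) \<Rightarrow> (nat \<Rightarrow> nat) \<Rightarrow> bool" where
  "fits \<beta> P [] hs vs \<longleftrightarrow> True"
| "fits \<beta> P ((i, j) # cs) hs vs \<longleftrightarrow>
     (touches P (i, j) (inside (\<beta> i)) \<longleftrightarrow> hs i \<noteq> 0) \<and> (touches P (i, j) South \<longleftrightarrow> vs j \<noteq> 0) \<and>
     (if elbow_at \<beta> P (i, j) then fits \<beta> P cs (hs(i := vs j)) (vs(j := hs i)) else fits \<beta> P cs hs vs)"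

definition weight_of :: "(nat \<Rightarrow> row_type) \<Rightarrow> 'a::comm_ring_1 \<Rightarrow> (nat \<times> nat \<Rightarrow> 'a) \<Rightarrow> filling \<Rightarrow> nat \<times> nat \<Rightarrow> 'a" where
  "weight_of \<beta> c a P x = (if elbow_at \<beta> P x then c else if P x = blank then c - a x else a x)"

lemma run_cong: "(\<And>x. x \<in> set cs \<Longrightarrow> E x = E' x) \<Longrightarrow> run E cs hs vs = run E' cs hs vs"
  by (induction E cs hs vs rule: run.induct) auto

lemma fits_cong: "(\<And>x. x \<in> set cs \<Longrightarrow> P x = P' x) \<Longrightarrow> fits \<beta> P cs hs vs = fits \<beta> P' cs hs vs"
  by (induction \<beta> P cs hs vs rule: fits.induct) (auto simp: touches_def elbow_at_def)

lemma sum_PiE_insert: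
  assumes "x \<notin> S"
  shows "(\<Sum>P\<in>PiE (insert x S) T. F P) = (\<Sum>y\<in>T x. \<Sum>P\<in>PiE S T. F (P(x := y)))"
proof -
  have inj: "inj_on (\<lambda>(y, g). g(x := y)) (T x \<times> PiE S T)" using assms by (rule inj_combinator)
  show ?thesis
    unfolding PiE_insert_eq sum.reindex[OF inj] sum.cartesian_product by (simp add: case_prod_unfold)
qed

lemma finite_tiles: "finite (tiles t)"
  by (cases t) (auto simp: tiles_def straight_tiles_def)

text \<open>Expanding the choice of the first tile leaves only the tiles of
  \<open>matching_tiles\<close>, and these produce the terms of \<open>cell_sum\<close>.\<close>

lemma cell_sum_fillings:
  assumes "distinct cs"
  shows "cell_sum c a cs hs vs f =
    (\<Sum>P\<in>PiE (set cs) (\<lambda>(i, j). tiles (\<beta> i)). if fits \<beta> P cs hs vs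
       then (\<Prod>x\<in>set cs. weight_of \<beta> c a P x) * (case run (elbow_at \<beta> P) cs hs vs of (hs, vs) \<Rightarrow> f hs vs) else 0)"
  using assms
proof (induction cs arbitrary: hs vs)
  case (Cons x cs)
  obtain i j where x: "x = (i, j)" by (cases x)
  define T where "T = (\<lambda>(i :: nat, j :: nat). tiles (\<beta> i))"
  define G where "G P hs vs = (if fits \<beta> P cs hs vs
       then (\<Prod>x\<in>set cs. weight_of \<beta> c a P x) * (case run (elbow_at \<beta> P) cs hs vs of (hs, vs) \<Rightarrow> f hs vs) else 0)" for P hs vs
  define S where "S hs vs = (\<Sum>P\<in>PiE (set cs) T. G P hs vs)" for hs vs
  define F where "F P = (if fits \<beta> P (x # cs) hs vs
       then (\<Prod>x\<in>set (x # cs). weight_of \<beta> c a P x) * (case run (elbow_at \<beta> P) (x # cs) hs vs of (hs, vs) \<Rightarrow> f hs vs) else 0)" for P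
  have IH: "cell_sum c a cs hs vs f = S hs vs" for hs vs
    using Cons by (simp add: S_def G_def T_def)
  define h where "h \<longleftrightarrow> hs i \<noteq> 0"
  define v where "v \<longleftrightarrow> vs j \<noteq> 0"
  have x_notin: "x \<notin> set cs" using Cons.prems by simp
  have F: "F (P(x := y)) = (if (inside (\<beta> i) \<in> \<Union>y \<longleftrightarrow> hs i \<noteq> 0) \<and> (South \<in> \<Union>y \<longleftrightarrow> vs j \<noteq> 0) then
      if y \<in> elbow_tiles (\<beta> i) then c * G P (hs(i := vs j)) (vs(j := hs i))
      else (if y = blank then c - a x else a x) * G P hs vs else 0)" for P y
  proof -
    have 1: "fits \<beta> (P(x := y)) cs hs vs = fits \<beta> P cs hs vs" for hs vs
      using x_notin by (intro fits_cong) auto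
    have 2: "run (elbow_at \<beta> (P(x := y))) cs hs vs = run (elbow_at \<beta> P) cs hs vs" for hs vs
      using x_notin by (intro run_cong) (auto simp: elbow_at_def)
    have 3: "(\<Prod>z\<in>set cs. weight_of \<beta> c a (P(x := y)) z) = (\<Prod>z\<in>set cs. weight_of \<beta> c a P z)"
      using x_notin by (intro prod.cong) (auto simp: weight_of_def elbow_at_def)
    have 4: "(\<Prod>z\<in>set (x # cs). weight_of \<beta> c a (P(x := y)) z) =
       weight_of \<beta> c a (P(x := y)) x * (\<Prod>z\<in>set cs. weight_of \<beta> c a P z)"
      using x_notin 3 by simp
    have 5: "elbow_at \<beta> (P(x := y)) (i, j) = (y \<in> elbow_tiles (\<beta> i))"
      "weight_of \<beta> c a (P(x := y)) x = (if y \<in> elbow_tiles (\<beta> i) then c else if y = blank then c - a x else a x)"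
      "touches (P(x := y)) (i, j) s = (s \<in> \<Union>y)" for s
      by (auto simp: elbow_at_def weight_of_def touches_def x)
    have 6: "fits \<beta> (P(x := y)) (x # cs) hs vs \<longleftrightarrow>
      (inside (\<beta> i) \<in> \<Union>y \<longleftrightarrow> hs i \<noteq> 0) \<and> (South \<in> \<Union>y \<longleftrightarrow> vs j \<noteq> 0) \<and>
      (if y \<in> elbow_tiles (\<beta> i) then fits \<beta> P cs (hs(i := vs j)) (vs(j := hs i)) else fits \<beta> P cs hs vs)"
      using 1 by (simp only: x fits.simps 5[unfolded x])
    have 7: "run (elbow_at \<beta> (P(x := y))) (x # cs) hs vs =
      (if y \<in> elbow_tiles (\<beta> i) then run (elbow_at \<beta> P) cs (hs(i := vs j)) (vs(j := hs i)) else run (elbow_at \<beta> P) cs hs vs)"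
      using 2 by (simp only: x run.simps 5[unfolded x])
    show ?thesis
      unfolding F_def 4 5(2) 6 7 G_def
      by (cases "y \<in> elbow_tiles (\<beta> i)"; cases "inside (\<beta> i) \<in> \<Union>y \<longleftrightarrow> hs i \<noteq> 0"; cases "South \<in> \<Union>y \<longleftrightarrow> vs j \<noteq> 0")
        (auto simp only: simp_thms if_True if_False mult.assoc mult_zero_right split: if_split)
  qed
  have "(\<Sum>P\<in>PiE (set (x # cs)) T. F P) = (\<Sum>y\<in>tiles (\<beta> i). \<Sum>P\<in>PiE (set cs) T. F (P(x := y)))"
    using sum_PiE_insert[OF x_notin, of F T] by (simp add: T_def x)
  also have "\<dots> = (\<Sum>y\<in>tiles (\<beta> i). if (inside (\<beta> i) \<in> \<Union>y \<longleftrightarrow> hs i \<noteq> 0) \<and> (South \<in> \<Union>y \<longleftrightarrow> vs j \<noteq> 0) then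
      if y \<in> elbow_tiles (\<beta> i) then c * S (hs(i := vs j)) (vs(j := hs i))
      else (if y = blank then c - a x else a x) * S hs vs else 0)"
  proof (rule sum.cong[OF refl])
    fix y
    show "(\<Sum>P\<in>PiE (set cs) T. F (P(x := y))) =
      (if (inside (\<beta> i) \<in> \<Union>y \<longleftrightarrow> hs i \<noteq> 0) \<and> (South \<in> \<Union>y \<longleftrightarrow> vs j \<noteq> 0) then
        if y \<in> elbow_tiles (\<beta> i) then c * S (hs(i := vs j)) (vs(j := hs i))
        else (if y = blank then c - a x else a x) * S hs vs else 0)"
      unfolding F S_def sum_distrib_left
      by (cases "(inside (\<beta> i) \<in> \<Union>y \<longleftrightarrow> hs i \<noteq> 0) \<and> (South \<in> \<Union>y \<longleftrightarrow> vs j \<noteq> 0)"; cases "y \<in> elbow_tiles (\<beta> i)")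
        (simp_all only: simp_thms if_True if_False sum.neutral_const)
  qed
  also have "\<dots> = (\<Sum>y\<in>{straight_tile h v, elbow_tile (\<beta> i) h v}.
      if y \<in> elbow_tiles (\<beta> i) then c * S (hs(i := vs j)) (vs(j := hs i))
      else (if y = blank then c - a x else a x) * S hs vs)"
    unfolding matching_tiles[symmetric] h_def v_def by (rule sum.inter_filter[symmetric]) (rule finite_tiles)
  also have "\<dots> = cell_sum c a (x # cs) hs vs f"
  proof (cases "h \<or> v")
    case False
    then have "hs i = 0" "vs j = 0" by (simp_all add: h_def v_def)
    then show ?thesis using False by (simp add: x IH)
  next
    case True
    then have "\<not> (hs i = 0 \<and> vs j = 0)" by (simp add: h_def v_def)
    moreover have "straight_tile h v \<noteq> elbow_tile (\<beta> i) h v"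
      using True by (metis straight_tile_elbow elbow_tile_elbow)
    moreover have "straight_tile h v \<noteq> blank" "elbow_tile (\<beta> i) h v \<in> elbow_tiles (\<beta> i)" using True by simp_all
    ultimately show ?thesis unfolding x cell_sum.simps IH by (simp only: if_not_P) auto
  qed
  finally show ?case by (simp only: F_def T_def)
qed simp

section \<open>Labels of the edges of a filling\<close>

lemma pipe_number_range:
  assumes "i \<in> {1..m}"
  shows "pipe_number m \<beta> i \<in> {1..m}"
proof (cases "\<beta> i")
  case w_row
  have "card {i'\<in>{1..i}. \<beta> i' = w_row} \<le> card {1..m}" using assms by (intro card_mono) auto
  moreover have "card {i'\<in>{1..i}. \<beta> i' = w_row} > 0" using assms w_row by (auto simp: card_gt_0_iff)
  ultimately show ?thesis by (simp add: pipe_number_def w_row)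
next
  case e_row
  have "card {i'\<in>{i..m}. \<beta> i' = e_row} > 0" using assms e_row by (auto simp: card_gt_0_iff)
  moreover have "card {i'\<in>{1..m}. \<beta> i' = w_row} + card {i'\<in>{i..m}. \<beta> i' = e_row} \<le> card {1..m}"
    using assms by (subst card_Un_disjoint[symmetric]) (auto intro!: card_mono simp del: card_atLeastAtMost)
  ultimately show ?thesis by (simp add: pipe_number_def e_row)
qed

lemma inj_pipe_number: "inj_on (pipe_number m \<beta>) {1..m}"
proof (rule linorder_inj_onI)
  fix i i' assume less: "i < i'" and i: "i \<in> {1..m}" "i' \<in> {1..m}"
  have ww: "card {l\<in>{1..i}. \<beta> l = w_row} < card {l\<in>{1..i'}. \<beta> l = w_row}" if "\<beta> i' = w_row"
  proof (rule psubset_card_mono)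
    have "{l\<in>{1..i}. \<beta> l = w_row} \<subseteq> {l\<in>{1..i'}. \<beta> l = w_row}" "i' \<notin> {l\<in>{1..i}. \<beta> l = w_row}"
      "i' \<in> {l\<in>{1..i'}. \<beta> l = w_row}" using that less i by auto
    then show "{l\<in>{1..i}. \<beta> l = w_row} \<subset> {l\<in>{1..i'}. \<beta> l = w_row}" by blast
  qed simp
  have ee: "card {l\<in>{i'..m}. \<beta> l = e_row} < card {l\<in>{i..m}. \<beta> l = e_row}" if "\<beta> i = e_row"
  proof (rule psubset_card_mono)
    have "{l\<in>{i'..m}. \<beta> l = e_row} \<subseteq> {l\<in>{i..m}. \<beta> l = e_row}" "i \<notin> {l\<in>{i'..m}. \<beta> l = e_row}"
      "i \<in> {l\<in>{i..m}. \<beta> l = e_row}" using that less i by auto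
    then show "{l\<in>{i'..m}. \<beta> l = e_row} \<subset> {l\<in>{i..m}. \<beta> l = e_row}" by blast
  qed simp
  have w: "card {l\<in>{1..k}. \<beta> l = w_row} \<le> card {l\<in>{1..m}. \<beta> l = w_row}" if "k \<in> {1..m}" for k
    using that by (intro card_mono) auto
  have e: "card {l\<in>{k..m}. \<beta> l = e_row} > 0" if "k \<in> {1..m}" "\<beta> k = e_row" for k
    using that by (auto simp: card_gt_0_iff)
  show "pipe_number m \<beta> i \<noteq> pipe_number m \<beta> i'"
    using ww ee w[of i] w[of i'] e[of i] e[of i'] i
    by (cases "\<beta> i"; cases "\<beta> i'") (auto simp: pipe_number_def)
qed auto

lemma pipe_number_surj:
  assumes "p \<in> {1..m}"
  shows "\<exists>i\<in>{1..m}. pipe_number m \<beta> i = p"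
proof -
  have "pipe_number m \<beta> ` {1..m} = {1..m}"
    using pipe_number_range inj_pipe_number by (intro endo_inj_surj) auto
  then show ?thesis using assms by (metis imageE)
qed

lemma pipe_number_w:
  assumes "\<beta> (Suc i) = w_row"
  shows "pipe_number m \<beta> (Suc i) = Suc (card {l\<in>{1..i}. \<beta> l = w_row})"
proof -
  have "{l\<in>{1..Suc i}. \<beta> l = w_row} = insert (Suc i) {l\<in>{1..i}. \<beta> l = w_row}" using assms by (auto simp: le_Suc_eq)
  then show ?thesis using assms by (simp add: pipe_number_def)
qed

text \<open>The shape matches \<open>block\<close>: the first summand is the smallest label left for
  the rows from \<open>Suc i\<close> on, and \<open>m - Suc i\<close> rows lie below, so this is the
  largest label left.\<close>

lemma pipe_number_e:
  assumes "\<beta> (Suc i) = e_row" "Suc i \<le> m"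
  shows "pipe_number m \<beta> (Suc i) = Suc (card {l\<in>{1..i}. \<beta> l = w_row}) + (m - Suc i)"
proof -
  have "{l\<in>{1..m}. \<beta> l = w_row} = {l\<in>{1..i}. \<beta> l = w_row} \<union> {l\<in>{Suc i..m}. \<beta> l = w_row}"
    using assms by auto
  then have "card {l\<in>{1..m}. \<beta> l = w_row} = card {l\<in>{1..i}. \<beta> l = w_row} + card {l\<in>{Suc i..m}. \<beta> l = w_row}"
    by (simp only:) (rule card_Un_disjoint, auto)
  moreover have "card {l\<in>{Suc i..m}. \<beta> l = w_row} + card {l\<in>{Suc i..m}. \<beta> l = e_row} = card {Suc i..m}"
  proof (subst card_Un_disjoint[symmetric])
    have "\<beta> l = w_row \<or> \<beta> l = e_row" for l by (cases "\<beta> l") auto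
    then have "{l\<in>{Suc i..m}. \<beta> l = w_row} \<union> {l\<in>{Suc i..m}. \<beta> l = e_row} = {Suc i..m}" by blast
    then show "card ({l\<in>{Suc i..m}. \<beta> l = w_row} \<union> {l\<in>{Suc i..m}. \<beta> l = e_row}) = card {Suc i..m}" by (rule arg_cong)
  qed auto
  ultimately show ?thesis using assms by (simp add: pipe_number_def)
qed

locale labelled_grid =
  fixes m n :: nat and \<beta> :: "nat \<Rightarrow> row_type"
  assumes m: "1 \<le> m" and n: "1 \<le> n"
begin

text \<open>The column of the \<open>t\<close>-th cell in the direction of travel. On
  \<open>{1..n}\<close> it is its own inverse, so it also converts columns into times.\<close>

definition col :: "nat \<Rightarrow> nat \<Rightarrow> nat" where
  "col i t = (if \<beta> i = w_row then t else Suc n - t)"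

lemma col_range: "t \<in> {1..n} \<Longrightarrow> col i t \<in> {1..n}"
  by (auto simp: col_def)

lemma col_col: "t \<in> {1..n} \<Longrightarrow> col i (col i t) = t"
  by (auto simp: col_def)

lemma col_image: "col i ` {1..n} = {1..n}"
proof
  show "{1..n} \<subseteq> col i ` {1..n}" using col_range col_col by (metis imageI subsetI)
qed (use col_range in auto)

primrec row_labels :: "filling \<Rightarrow> nat \<Rightarrow> (nat \<Rightarrow> nat) \<Rightarrow> nat \<Rightarrow> nat" where
  "row_labels P i V 0 = pipe_number m \<beta> i"
| "row_labels P i V (Suc t) = (if elbow_at \<beta> P (i, col i (Suc t)) then V (col i (Suc t)) else row_labels P i V t)"

text \<open>\<open>vlab P d\<close> labels the edges above the lowest \<open>d\<close> rows, and \<open>hlab P i t\<close> the edge of row \<open>i\<close> that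
  a pipe entering this row passes after \<open>t\<close> cells; empty edges have label \<open>0\<close>.\<close>

primrec vlab :: "filling \<Rightarrow> nat \<Rightarrow> nat \<Rightarrow> nat" where
  "vlab P 0 = (\<lambda>_. 0)"
| "vlab P (Suc d) = (\<lambda>j. if j \<in> {1..n}
     then if elbow_at \<beta> P (m - d, j) then row_labels P (m - d) (vlab P d) (col (m - d) j - 1) else vlab P d j else 0)"

definition hlab :: "filling \<Rightarrow> nat \<Rightarrow> nat \<Rightarrow> nat" where
  "hlab P i = row_labels P i (vlab P (m - i))"

lemma vlab_outside: "j \<notin> {1..n} \<Longrightarrow> vlab P d j = 0"
  by (cases d) auto

lemma hlab_0: "hlab P i 0 = pipe_number m \<beta> i"
  by (simp add: hlab_def)

lemma hlab_step:
  "t \<in> {1..n} \<Longrightarrow> hlab P i t = (if elbow_at \<beta> P (i, col i t) then vlab P (m - i) (col i t) else hlab P i (t - 1))"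
  by (cases t) (auto simp: hlab_def)

lemma vlab_step:
  assumes "i \<in> {1..m}" "t \<in> {1..n}"
  shows "vlab P (Suc (m - i)) (col i t) = (if elbow_at \<beta> P (i, col i t) then hlab P i (t - 1) else vlab P (m - i) (col i t))"
proof -
  have "m - (m - i) = i" using assms by simp
  then show ?thesis using assms col_range[OF assms(2), of i] col_col[OF assms(2), of i] by (simp add: hlab_def)
qed

text \<open>The cells in the order in which pipes can visit them: bottom row first, each row in its direction.\<close>

definition row_cells :: "nat \<Rightarrow> (nat \<times> nat) list" where
  "row_cells i = map (\<lambda>t. (i, col i t)) [1..<Suc n]"

primrec cells :: "nat \<Rightarrow> (nat \<times> nat) list" where
  "cells 0 = []"
| "cells (Suc k) = row_cells (Suc k) @ cells k"

definition cell_fits :: "filling \<Rightarrow> nat \<Rightarrow> nat \<Rightarrow> bool" where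
  "cell_fits P i t \<longleftrightarrow> (touches P (i, col i t) (inside (\<beta> i)) \<longleftrightarrow> hlab P i (t - 1) \<noteq> 0) \<and>
     (touches P (i, col i t) South \<longleftrightarrow> vlab P (m - i) (col i t) \<noteq> 0)"

text \<open>\<open>V t\<close> is the state of the columns after \<open>t\<close> cells of the row:
  the columns already passed have their new labels, the others still their old ones.\<close>

lemma traverse_row:
  fixes P
  assumes i: "i \<in> {1..m}" and t: "t \<le> n"
  defines "V \<equiv> \<lambda>t j. if j \<in> col i ` {1..t} then vlab P (Suc (m - i)) j else vlab P (m - i) j"
  shows "fits \<beta> P (map (\<lambda>t. (i, col i t)) [Suc t..<Suc n] @ cs) (hs(i := hlab P i t)) (V t) \<longleftrightarrow>
      (\<forall>u\<in>{t<..n}. cell_fits P i u) \<and> fits \<beta> P cs (hs(i := hlab P i n)) (V n)"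
    "run (elbow_at \<beta> P) (map (\<lambda>t. (i, col i t)) [Suc t..<Suc n] @ cs) (hs(i := hlab P i t)) (V t)
      = run (elbow_at \<beta> P) cs (hs(i := hlab P i n)) (V n)"
proof -
  have "(fits \<beta> P (map (\<lambda>t. (i, col i t)) [Suc t..<Suc n] @ cs) (hs(i := hlab P i t)) (V t) \<longleftrightarrow>
      (\<forall>u\<in>{t<..n}. cell_fits P i u) \<and> fits \<beta> P cs (hs(i := hlab P i n)) (V n)) \<and>
    run (elbow_at \<beta> P) (map (\<lambda>t. (i, col i t)) [Suc t..<Suc n] @ cs) (hs(i := hlab P i t)) (V t)
      = run (elbow_at \<beta> P) cs (hs(i := hlab P i n)) (V n)"
    using t
  proof (induction t rule: inc_induct)
    case base
    then show ?case by simp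
  next
    case (step t)
    define j where "j = col i (Suc t)"
    have range: "Suc t \<in> {1..n}" using step by simp
    have upt: "[Suc t..<Suc n] = Suc t # [Suc (Suc t)..<Suc n]" using step by (intro upt_conv_Cons) simp
    have j: "j \<notin> col i ` {1..t}"
    proof
      assume "j \<in> col i ` {1..t}"
      then obtain u where u: "u \<in> {1..t}" "j = col i u" by auto
      then have "col i j = u" using col_col[of u i] step by auto
      then show False using col_col[OF range, of i] u by (simp add: j_def)
    qed
    then have Vj: "V t j = vlab P (m - i) j" by (simp add: V_def)
    have VSuc: "V (Suc t) = (V t)(j := vlab P (Suc (m - i)) j)"
      by (auto simp: V_def fun_eq_iff j_def atLeastAtMostSuc_conv simp del: vlab.simps)
    note vs = vlab_step[OF i range, of P, folded j_def]
    note hs = hlab_step[OF range, of P i, folded j_def]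
    have cell: "cell_fits P i (Suc t) \<longleftrightarrow> (touches P (i, j) (inside (\<beta> i)) \<longleftrightarrow> hlab P i t \<noteq> 0) \<and>
        (touches P (i, j) South \<longleftrightarrow> V t j \<noteq> 0)"
      unfolding Vj by (simp add: cell_fits_def j_def)
    have ivl: "{t<..n} = insert (Suc t) {Suc t<..n}" using step by auto
    show ?case
    proof (cases "elbow_at \<beta> P (i, j)")
      case True
      then have 1: "V (Suc t) = (V t)(j := hlab P i t)" "hlab P i (Suc t) = V t j"
        using VSuc vs hs Vj by auto
      show ?thesis
        using step.IH True by (simp only: upt list.map append_Cons fits.simps run.simps if_True fun_upd_same
          fun_upd_upd ivl ball_simps cell 1 j_def[symmetric] simp_thms conj_assoc)
    next
      case False
      then have 1: "V (Suc t) = V t" "hlab P i (Suc t) = hlab P i t"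
        using VSuc vs hs Vj by auto
      show ?thesis
        using step.IH False by (simp only: upt list.map append_Cons fits.simps run.simps if_False fun_upd_same
          fun_upd_upd ivl ball_simps cell 1 j_def[symmetric] simp_thms conj_assoc)
    qed
  qed
  then show "fits \<beta> P (map (\<lambda>t. (i, col i t)) [Suc t..<Suc n] @ cs) (hs(i := hlab P i t)) (V t) \<longleftrightarrow>
      (\<forall>u\<in>{t<..n}. cell_fits P i u) \<and> fits \<beta> P cs (hs(i := hlab P i n)) (V n)"
    "run (elbow_at \<beta> P) (map (\<lambda>t. (i, col i t)) [Suc t..<Suc n] @ cs) (hs(i := hlab P i t)) (V t)
      = run (elbow_at \<beta> P) cs (hs(i := hlab P i n)) (V n)" by blast+
qed

text \<open>In \<open>hs k\<close> the rows below row \<open>k\<close> are finished and show their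
  exit labels. The sequential test \<open>fits\<close> thereby becomes a condition on each cell
  separately.\<close>

lemma traverse_cells:
  fixes P
  assumes "k \<le> m"
  defines "hs \<equiv> \<lambda>k i. if i \<in> {k<..m} then hlab P i n else pipe_number m \<beta> i"
  shows "fits \<beta> P (cells k) (hs k) (vlab P (m - k)) \<longleftrightarrow> (\<forall>i\<in>{1..k}. \<forall>t\<in>{1..n}. cell_fits P i t)"
    and "run (elbow_at \<beta> P) (cells k) (hs k) (vlab P (m - k)) = (hs 0, vlab P m)"
proof -
  have "(fits \<beta> P (cells k) (hs k) (vlab P (m - k)) \<longleftrightarrow> (\<forall>i\<in>{1..k}. \<forall>t\<in>{1..n}. cell_fits P i t)) \<and>
    run (elbow_at \<beta> P) (cells k) (hs k) (vlab P (m - k)) = (hs 0, vlab P m)"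
    using assms(1)
  proof (induction k)
    case (Suc k)
    let ?i = "Suc k"
    have i: "?i \<in> {1..m}" using Suc by simp
    have 1: "(\<lambda>j. if j \<in> col ?i ` {1..0} then vlab P (Suc (m - ?i)) j else vlab P (m - ?i) j) = vlab P (m - ?i)" by simp
    have d: "Suc (m - ?i) = m - k" using i by simp
    have 2: "(\<lambda>j. if j \<in> col ?i ` {1..n} then vlab P (Suc (m - ?i)) j else vlab P (m - ?i) j) = vlab P (m - k)"
      unfolding col_image d using vlab_outside by (auto simp: fun_eq_iff)
    have 3: "(hs ?i)(?i := hlab P ?i 0) = hs ?i" by (auto simp: hs_def hlab_0)
    have 4: "(hs ?i)(?i := hlab P ?i n) = hs k" using i by (auto simp: hs_def fun_eq_iff)
    have cells: "cells ?i = map (\<lambda>t. (?i, col ?i t)) [Suc 0..<Suc n] @ cells k" by (simp add: row_cells_def)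
    have "fits \<beta> P (cells ?i) (hs ?i) (vlab P (m - ?i)) \<longleftrightarrow>
        (\<forall>t\<in>{0<..n}. cell_fits P ?i t) \<and> fits \<beta> P (cells k) (hs k) (vlab P (m - k))"
      "run (elbow_at \<beta> P) (cells ?i) (hs ?i) (vlab P (m - ?i)) = run (elbow_at \<beta> P) (cells k) (hs k) (vlab P (m - k))"
      using traverse_row[OF i, where t = 0 and hs = "hs ?i" and cs = "cells k" and P = P, OF le0]
      unfolding 1 2 3 4 cells by blast+
    moreover have "(\<forall>i\<in>{1..?i}. \<forall>t\<in>{1..n}. cell_fits P i t) \<longleftrightarrow>
        (\<forall>t\<in>{0<..n}. cell_fits P ?i t) \<and> (\<forall>i\<in>{1..k}. \<forall>t\<in>{1..n}. cell_fits P i t)"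
    proof -
      have "{1..?i} = insert ?i {1..k}" "{0<..n} = {1..n}" by auto
      then show ?thesis by simp
    qed
    ultimately show ?case using Suc.IH[OF Suc_leD[OF Suc.prems]] by (simp only: simp_thms)
  qed (simp add: hs_def)
  then show "fits \<beta> P (cells k) (hs k) (vlab P (m - k)) \<longleftrightarrow> (\<forall>i\<in>{1..k}. \<forall>t\<in>{1..n}. cell_fits P i t)"
    "run (elbow_at \<beta> P) (cells k) (hs k) (vlab P (m - k)) = (hs 0, vlab P m)" by blast+
qed

lemma set_cells: "set (cells k) = {1..k} \<times> {1..n}"
proof (induction k)
  case (Suc k)
  have "set (row_cells (Suc k)) = Pair (Suc k) ` col (Suc k) ` {1..n}"
    by (simp add: row_cells_def image_image atLeastLessThanSuc_atLeastAtMost del: upt_Suc)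
  then have "set (row_cells (Suc k)) = {Suc k} \<times> {1..n}" unfolding col_image by auto
  then show ?case using Suc by (auto simp: le_Suc_eq)
qed simp

lemma distinct_cells: "distinct (cells k)"
proof (induction k)
  case (Suc k)
  have "inj_on (\<lambda>t. (Suc k, col (Suc k) t)) {1..<Suc n}"
    by (rule inj_on_inverseI[where g = "\<lambda>x. col (Suc k) (snd x)"]) (auto simp: col_col)
  then have "distinct (row_cells (Suc k))" by (simp add: row_cells_def distinct_map del: upt_Suc)
  moreover have "set (row_cells (Suc k)) \<subseteq> {Suc k} \<times> UNIV" by (auto simp: row_cells_def)
  ultimately show ?case using Suc set_cells[of k] by auto
qed simp

end

section \<open>Pipe dreams and their connectivity\<close>

context labelled_grid begin

lemma tile_exits:
  assumes "P (i, j) \<in> tiles (\<beta> i)"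
  shows "touches P (i, j) (outside (\<beta> i)) \<longleftrightarrow>
      (if elbow_at \<beta> P (i, j) then touches P (i, j) South else touches P (i, j) (inside (\<beta> i)))"
    and "touches P (i, j) North \<longleftrightarrow>
      (if elbow_at \<beta> P (i, j) then touches P (i, j) (inside (\<beta> i)) else touches P (i, j) South)"
  using assms by (cases rule: tile_cases; simp add: touches_def elbow_at_def del: Union_iff)+

lemma cell_fits_exits:
  assumes "P (i, col i t) \<in> tiles (\<beta> i)" "i \<in> {1..m}" "t \<in> {1..n}" "cell_fits P i t"
  shows "touches P (i, col i t) (outside (\<beta> i)) \<longleftrightarrow> hlab P i t \<noteq> 0"
    and "touches P (i, col i t) North \<longleftrightarrow> vlab P (Suc (m - i)) (col i t) \<noteq> 0"
  using assms(4) unfolding tile_exits[of P i, OF assms(1)] hlab_step[OF assms(3)] vlab_step[OF assms(2,3)] cell_fits_def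
  by auto

text \<open>Stating the conditions in the direction of travel lets both types be treated at once
  from here on.\<close>

lemma pipe_dreams_iff_adjacent:
  "P \<in> pipe_dreams m n \<beta> \<longleftrightarrow> P \<in> (\<Pi>\<^sub>E (i, j)\<in>grid m n. tiles (\<beta> i)) \<and>
     (\<forall>i\<in>{1..m}. (\<forall>t\<in>{1..<n}. touches P (i, col i t) (outside (\<beta> i)) \<longleftrightarrow> touches P (i, col i (Suc t)) (inside (\<beta> i))) \<and>
        touches P (i, col i 1) (inside (\<beta> i)) \<and> \<not> touches P (i, col i n) (outside (\<beta> i))) \<and>
     (\<forall>i\<in>{1..<m}. \<forall>j\<in>{1..n}. touches P (i, j) South \<longleftrightarrow> touches P (Suc i, j) North) \<and>
     (\<forall>j\<in>{1..n}. \<not> touches P (m, j) South)"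
proof -
  have row: "((\<forall>j\<in>{1..<n}. touches P (i, j) East \<longleftrightarrow> touches P (i, Suc j) West) \<and>
     (\<beta> i = w_row \<longrightarrow> touches P (i, 1) West \<and> \<not> touches P (i, n) East) \<and>
     (\<beta> i = e_row \<longrightarrow> touches P (i, n) East \<and> \<not> touches P (i, 1) West)) \<longleftrightarrow>
     (\<forall>t\<in>{1..<n}. touches P (i, col i t) (outside (\<beta> i)) \<longleftrightarrow> touches P (i, col i (Suc t)) (inside (\<beta> i))) \<and>
        touches P (i, col i 1) (inside (\<beta> i)) \<and> \<not> touches P (i, col i n) (outside (\<beta> i))" for i
  proof (cases "\<beta> i")
    case w_row
    then show ?thesis by (simp add: col_def)
  next
    \<comment> \<open>Travelling West, a pipe meets the edge between columns \<open>j\<close> and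
      \<open>j + 1\<close> after \<open>n - j\<close> cells; hence the reindexing by
      \<open>n - t\<close>.\<close>
    case e_row
    have "(\<forall>j\<in>{1..<n}. touches P (i, j) East \<longleftrightarrow> touches P (i, Suc j) West) \<longleftrightarrow>
      (\<forall>j\<in>(\<lambda>t. n - t) ` {1..<n}. touches P (i, j) East \<longleftrightarrow> touches P (i, Suc j) West)"
    proof -
      have "x \<in> (\<lambda>t. n - t) ` {1..<n}" if "x \<in> {1..<n}" for x
        using that by (intro image_eqI[of _ _ "n - x"]) auto
      then have "(\<lambda>t. n - t) ` {1..<n} = {1..<n}" by auto
      then show ?thesis by simp
    qed
    also have "\<dots> \<longleftrightarrow> (\<forall>t\<in>{1..<n}. touches P (i, Suc n - t) West \<longleftrightarrow> touches P (i, n - t) East)"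
      by (auto simp: Suc_diff_le)
    finally show ?thesis using e_row by (simp add: col_def)
  qed
  show ?thesis unfolding pipe_dreams_def row[symmetric] by blast
qed

lemma pipe_dream_row_fits:
  assumes P: "P \<in> pipe_dreams m n \<beta>" and i: "i \<in> {1..m}"
    and south: "\<And>j. j \<in> {1..n} \<Longrightarrow> touches P (i, j) South \<longleftrightarrow> vlab P (m - i) j \<noteq> 0"
    and "t \<in> {1..n}"
  shows "cell_fits P i t"
  using \<open>t \<in> {1..n}\<close>
proof (induction t)
  case (Suc t)
  note adj = P[unfolded pipe_dreams_iff_adjacent]
  have range: "Suc t \<in> {1..n}" by fact
  have "touches P (i, col i (Suc t)) (inside (\<beta> i)) \<longleftrightarrow> hlab P i t \<noteq> 0"
  proof (cases "t = 0")
    case True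
    then show ?thesis using adj i pipe_number_range[of i m \<beta>] by (auto simp: hlab_0)
  next
    case False
    then have t: "t \<in> {1..<n}" "t \<in> {1..n}" using range by auto
    have "P (i, col i t) \<in> tiles (\<beta> i)" using adj i col_range[OF t(2)] by (auto simp: grid_def PiE_def Pi_def)
    then have "touches P (i, col i t) (outside (\<beta> i)) \<longleftrightarrow> hlab P i t \<noteq> 0"
      using cell_fits_exits(1) i t Suc.IH by blast
    then show ?thesis using adj i t by auto
  qed
  then show ?case using south[OF col_range[OF range]] by (simp add: cell_fits_def)
qed simp

text \<open>The South boundary is empty like \<open>vlab P 0\<close>; going up, the North edges of a
  row are the South edges of the next.\<close>

lemma pipe_dream_cell_fits:
  assumes P: "P \<in> pipe_dreams m n \<beta>" and "i \<in> {1..m}" "t \<in> {1..n}"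
  shows "cell_fits P i t"
proof -
  note adj = P[unfolded pipe_dreams_iff_adjacent]
  have tiles: "P (i, j) \<in> tiles (\<beta> i)" if "i \<in> {1..m}" "j \<in> {1..n}" for i j
    using adj that by (auto simp: grid_def PiE_def Pi_def)
  have "\<forall>t\<in>{1..n}. cell_fits P (m - d) t" if "d < m" for d
    using that
  proof (induction d)
    case 0
    then show ?case using adj by (intro ballI pipe_dream_row_fits[OF P]) auto
  next
    case (Suc d)
    let ?i = "m - Suc d"
    have i: "?i \<in> {1..<m}" "Suc ?i = m - d" "m - ?i = Suc d" using Suc.prems by auto
    have "touches P (?i, j) South \<longleftrightarrow> vlab P (m - ?i) j \<noteq> 0" if "j \<in> {1..n}" for j
    proof -
      have "touches P (?i, j) South \<longleftrightarrow> touches P (m - d, j) North" using adj i that by auto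
      also have "\<dots> \<longleftrightarrow> touches P (m - d, col (m - d) (col (m - d) j)) North" using col_col[OF that] by simp
      also have "\<dots> \<longleftrightarrow> vlab P (Suc (m - (m - d))) (col (m - d) (col (m - d) j)) \<noteq> 0"
        by (rule cell_fits_exits(2)) (use Suc i that tiles col_range col_col in auto)
      finally show ?thesis using col_col[OF that] Suc.prems by simp
    qed
    then show ?case using i by (intro ballI pipe_dream_row_fits[OF P]) auto
  qed
  from this[of "m - i"] show ?thesis using assms by simp
qed

text \<open>Neighbouring cells read the same label on their common edge, so they match as soon as
  each cell agrees with its labels. What is left of the boundary conditions is that every row ends
  empty.\<close>

lemma pipe_dreams_iff:
  "P \<in> pipe_dreams m n \<beta> \<longleftrightarrow> P \<in> (\<Pi>\<^sub>E (i, j)\<in>grid m n. tiles (\<beta> i)) \<and>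
     (\<forall>i\<in>{1..m}. \<forall>t\<in>{1..n}. cell_fits P i t) \<and> (\<forall>i\<in>{1..m}. hlab P i n = 0)"
proof (intro iffI conjI ballI)
  assume P: "P \<in> pipe_dreams m n \<beta>"
  then show tiles: "P \<in> (\<Pi>\<^sub>E (i, j)\<in>grid m n. tiles (\<beta> i))" by (simp add: pipe_dreams_def)
  show fits: "cell_fits P i t" if "i \<in> {1..m}" "t \<in> {1..n}" for i t
    using P that by (rule pipe_dream_cell_fits)
  show "hlab P i n = 0" if i: "i \<in> {1..m}" for i
  proof -
    have "P (i, col i n) \<in> tiles (\<beta> i)" using tiles i n col_range[of n i] by (auto simp: grid_def PiE_def Pi_def)
    then show ?thesis using cell_fits_exits(1)[of P i n] fits[of i n] P[unfolded pipe_dreams_iff_adjacent] i n by auto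
  qed
next
  assume *: "P \<in> (\<Pi>\<^sub>E (i, j)\<in>grid m n. tiles (\<beta> i)) \<and>
     (\<forall>i\<in>{1..m}. \<forall>t\<in>{1..n}. cell_fits P i t) \<and> (\<forall>i\<in>{1..m}. hlab P i n = 0)"
  then have tiles: "P (i, j) \<in> tiles (\<beta> i)" if "i \<in> {1..m}" "j \<in> {1..n}" for i j
    using that by (auto simp: grid_def PiE_def Pi_def)
  have ins: "touches P (i, col i t) (inside (\<beta> i)) \<longleftrightarrow> hlab P i (t - 1) \<noteq> 0" if "i \<in> {1..m}" "t \<in> {1..n}" for i t
    using * that by (auto simp: cell_fits_def)
  have south: "touches P (i, j) South \<longleftrightarrow> vlab P (m - i) j \<noteq> 0" if "i \<in> {1..m}" "j \<in> {1..n}" for i j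
  proof -
    have "cell_fits P i (col i j)" using * that col_range[of j i] by blast
    then show ?thesis using col_col[of j i] that by (simp add: cell_fits_def)
  qed
  have out: "touches P (i, col i t) (outside (\<beta> i)) \<longleftrightarrow> hlab P i t \<noteq> 0" if "i \<in> {1..m}" "t \<in> {1..n}" for i t
    using cell_fits_exits(1)[of P i t] * tiles that col_range by blast
  have north: "touches P (i, j) North \<longleftrightarrow> vlab P (Suc (m - i)) j \<noteq> 0" if "i \<in> {1..m}" "j \<in> {1..n}" for i j
    using cell_fits_exits(2)[of P i "col i j"] * tiles[of i j] that col_range[of j i] col_col[of j i] by simp
  \<comment> \<open>Pipe numbers are positive, so 0 is free to mean an empty edge, and the entry
    edges count as occupied.\<close>
  have "pipe_number m \<beta> i \<noteq> 0" if "i \<in> {1..m}" for i using pipe_number_range[OF that, of \<beta>] by simp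
  then show "P \<in> pipe_dreams m n \<beta>"
    unfolding pipe_dreams_iff_adjacent
    using * n m by (auto simp: ins out south north hlab_0 Suc_diff_Suc simp del: vlab.simps(2))
qed

text \<open>This decodes the coordinates of \<open>midpoint\<close>. An odd first coordinate
  \<open>r\<close> belongs to an edge crossed vertically, with \<open>r div 2\<close> rows above it;
  otherwise the edge lies in row \<open>r div 2\<close>, and the second coordinate gives the number
  of cells passed, counted from the entry side.\<close>

definition label :: "filling \<Rightarrow> nat \<times> nat \<Rightarrow> nat" where
  "label P = (\<lambda>(r, c). if odd r then vlab P (m - r div 2) (c div 2)
     else hlab P (r div 2) (if \<beta> (r div 2) = w_row then c div 2 else n - c div 2))"

lemma label_sides:
  assumes "i \<in> {1..m}" "t \<in> {1..n}"
  shows "label P (midpoint (i, col i t) North) = vlab P (Suc (m - i)) (col i t)"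
    and "label P (midpoint (i, col i t) South) = vlab P (m - i) (col i t)"
    and "label P (midpoint (i, col i t) (inside (\<beta> i))) = hlab P i (t - 1)"
    and "label P (midpoint (i, col i t) (outside (\<beta> i))) = hlab P i t"
proof -
  have "(2 * i - 1) div 2 = i - 1" "m - (i - 1) = Suc (m - i)" "odd (2 * i - 1)" using assms by auto
  then show "label P (midpoint (i, col i t) North) = vlab P (Suc (m - i)) (col i t)"
    by (simp add: label_def del: vlab.simps)
  show "label P (midpoint (i, col i t) South) = vlab P (m - i) (col i t)"
    by (simp add: label_def)
  have "(2 * j - Suc 0) div 2 = j - 1" for j :: nat by (cases j) auto
  then show "label P (midpoint (i, col i t) (inside (\<beta> i))) = hlab P i (t - 1)"
    "label P (midpoint (i, col i t) (outside (\<beta> i))) = hlab P i t"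
    using assms by (cases "\<beta> i"; simp add: label_def col_def Suc_diff_le)+
qed

lemma label_segment:
  assumes "P (i, col i t) \<in> tiles (\<beta> i)" "i \<in> {1..m}" "t \<in> {1..n}" "{s, s'} \<in> P (i, col i t)"
  shows "label P (midpoint (i, col i t) s) = label P (midpoint (i, col i t) s')"
proof -
  note labels = label_sides[OF assms(2,3), of P] vlab_step[OF assms(2,3), of P] hlab_step[OF assms(3), of P i]
  have we: "{West, East} = {inside (\<beta> i), outside (\<beta> i)}" by (cases "\<beta> i") auto
  from assms(1) show ?thesis
  proof (cases rule: tile_cases)
    case (1 h v)
    then have "{s, s'} = {inside (\<beta> i), outside (\<beta> i)} \<or> {s, s'} = {South, North}"
      using assms(4) by (auto simp: straight_tile_def we split: if_splits)
    moreover have "\<not> elbow_at \<beta> P (i, col i t)" using 1 by (simp add: elbow_at_def)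
    ultimately show ?thesis using labels by (auto simp: doubleton_eq_iff simp del: vlab.simps)
  next
    case (2 h v)
    then have "{s, s'} = {inside (\<beta> i), North} \<or> {s, s'} = {South, outside (\<beta> i)}"
      using assms(4) by (auto simp: elbow_tile_def split: if_splits)
    moreover have "elbow_at \<beta> P (i, col i t)" using 2 by (simp add: elbow_at_def)
    ultimately show ?thesis using labels by (auto simp: doubleton_eq_iff simp del: vlab.simps)
  qed
qed

lemma label_path:
  assumes tiles: "\<And>i j. i \<in> {1..m} \<Longrightarrow> j \<in> {1..n} \<Longrightarrow> P (i, j) \<in> tiles (\<beta> i)"
    and "(e, e') \<in> (segments m n P)\<^sup>*"
  shows "label P e = label P e'"
  using assms(2)
proof (induction rule: rtrancl_induct)
  case (step e e')
  then obtain i j s s' where c: "i \<in> {1..m}" "j \<in> {1..n}" "{s, s'} \<in> P (i, j)"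
    "e = midpoint (i, j) s" "e' = midpoint (i, j) s'"
    by (auto simp: segments_def grid_def)
  then show ?case using step.IH label_segment[of P i "col i j" s s'] tiles[OF c(1,2)] col_col[OF c(2), of i] col_range[OF c(2), of i]
    by simp
qed simp

text \<open>\<open>hedge i t\<close> carries \<open>hlab P i t\<close>, and \<open>vedge i j\<close>
  below carries \<open>vlab P (m - i) j\<close>; thus \<open>vedge 0 j\<close> is on the North
  boundary.\<close>

definition hedge :: "nat \<Rightarrow> nat \<Rightarrow> nat \<times> nat" where
  "hedge i t = (2 * i, if \<beta> i = w_row then 2 * t + 1 else 2 * (n - t) + 1)"

definition vedge :: "nat \<Rightarrow> nat \<Rightarrow> nat \<times> nat" where
  "vedge i j = (2 * i + 1, 2 * j)"

lemma midpoint_edges: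
  assumes "i \<ge> 1" "t \<in> {1..n}"
  shows "midpoint (i, col i t) (inside (\<beta> i)) = hedge i (t - 1)"
    "midpoint (i, col i t) (outside (\<beta> i)) = hedge i t"
    "midpoint (i, j) South = vedge i j" "midpoint (i, j) North = vedge (i - 1) j"
proof -
  show "midpoint (i, j) South = vedge i j" "midpoint (i, j) North = vedge (i - 1) j"
    using assms by (auto simp: vedge_def)
  show "midpoint (i, col i t) (inside (\<beta> i)) = hedge i (t - 1)"
    "midpoint (i, col i t) (outside (\<beta> i)) = hedge i t"
    using assms by (cases "\<beta> i"; auto simp: hedge_def col_def)+
qed

lemma entry_point_hedge: "entry_point n \<beta> i = hedge i 0"
  by (cases "\<beta> i") (auto simp: entry_point_def hedge_def)

definition reaches :: "filling \<Rightarrow> nat \<Rightarrow> nat \<times> nat \<Rightarrow> bool" where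
  "reaches P p e \<longleftrightarrow> (\<exists>i\<in>{1..m}. pipe_number m \<beta> i = p \<and> (entry_point n \<beta> i, e) \<in> (segments m n P)\<^sup>*)"

lemma reaches_step:
  assumes "reaches P p (midpoint c s)" "c \<in> grid m n" "{s, s'} \<in> P c"
  shows "reaches P p (midpoint c s')"
proof -
  have "(midpoint c s, midpoint c s') \<in> segments m n P" using assms(2,3) unfolding segments_def by blast
  then show ?thesis using assms(1) unfolding reaches_def by (meson rtrancl.rtrancl_into_rtrancl)
qed

lemma cell_reaches:
  assumes tile: "P (i, col i t) \<in> tiles (\<beta> i)" and i: "i \<in> {1..m}" and t: "t \<in> {1..n}" and fits: "cell_fits P i t"
    and h: "hlab P i (t - 1) \<noteq> 0 \<Longrightarrow> reaches P (hlab P i (t - 1)) (hedge i (t - 1))"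
    and v: "vlab P (m - i) (col i t) \<noteq> 0 \<Longrightarrow> reaches P (vlab P (m - i) (col i t)) (vedge i (col i t))"
  shows "hlab P i t \<noteq> 0 \<Longrightarrow> reaches P (hlab P i t) (hedge i t)"
    and "vlab P (Suc (m - i)) (col i t) \<noteq> 0 \<Longrightarrow> reaches P (vlab P (Suc (m - i)) (col i t)) (vedge (i - 1) (col i t))"
proof -
  let ?c = "(i, col i t)"
  have c: "?c \<in> grid m n" using i col_range[OF t] by (simp add: grid_def)
  have i1: "i \<ge> 1" using i by simp
  note edges = midpoint_edges[OF i1 t]
  have pass: "reaches P p (midpoint ?c s')" if "reaches P p (midpoint ?c s)" "{s, s'} \<in> P ?c" for p s s'
    using reaches_step[OF that(1) c that(2)] .
  have we: "{West, East} = {inside (\<beta> i), outside (\<beta> i)}" by (cases "\<beta> i") auto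
  have "(hlab P i t \<noteq> 0 \<longrightarrow> reaches P (hlab P i t) (hedge i t)) \<and>
    (vlab P (Suc (m - i)) (col i t) \<noteq> 0 \<longrightarrow> reaches P (vlab P (Suc (m - i)) (col i t)) (vedge (i - 1) (col i t)))"
    using tile
  proof (cases rule: tile_cases)
    case (1 h v)
    then have flags: "h \<longleftrightarrow> hlab P i (t - 1) \<noteq> 0" "v \<longleftrightarrow> vlab P (m - i) (col i t) \<noteq> 0"
      using fits unfolding cell_fits_def touches_def by (simp_all only: side_sets)
    have "\<not> elbow_at \<beta> P ?c" using 1 by (simp add: elbow_at_def)
    then have lab: "hlab P i t = hlab P i (t - 1)" "vlab P (Suc (m - i)) (col i t) = vlab P (m - i) (col i t)"
      using hlab_step[OF t, of P i] vlab_step[OF i t, of P] by simp_all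
    have "h \<Longrightarrow> {inside (\<beta> i), outside (\<beta> i)} \<in> P ?c" "v \<Longrightarrow> {South, North} \<in> P ?c"
      using 1 by (auto simp: straight_tile_def we)
    then show ?thesis unfolding lab using flags pass h v by (metis edges)
  next
    case (2 h v)
    then have flags: "h \<longleftrightarrow> hlab P i (t - 1) \<noteq> 0" "v \<longleftrightarrow> vlab P (m - i) (col i t) \<noteq> 0"
      using fits unfolding cell_fits_def touches_def by (simp_all only: side_sets)
    have "elbow_at \<beta> P ?c" using 2 by (simp add: elbow_at_def)
    then have lab: "hlab P i t = vlab P (m - i) (col i t)" "vlab P (Suc (m - i)) (col i t) = hlab P i (t - 1)"
      using hlab_step[OF t, of P i] vlab_step[OF i t, of P] by simp_all
    have "h \<Longrightarrow> {inside (\<beta> i), North} \<in> P ?c" "v \<Longrightarrow> {South, outside (\<beta> i)} \<in> P ?c"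
      using 2 by (auto simp: elbow_tile_def)
    then show ?thesis unfolding lab using flags pass h v by (metis edges)
  qed
  then show "hlab P i t \<noteq> 0 \<Longrightarrow> reaches P (hlab P i t) (hedge i t)"
    "vlab P (Suc (m - i)) (col i t) \<noteq> 0 \<Longrightarrow> reaches P (vlab P (Suc (m - i)) (col i t)) (vedge (i - 1) (col i t))" by blast+
qed

text \<open>Every nonzero label is witnessed by a path from an entry of its pipe: segments transmit
  this property in the order in which the labels are computed.\<close>

lemma vlab_reaches:
  assumes P: "P \<in> pipe_dreams m n \<beta>" and "d \<le> m" "j \<in> {1..n}" "vlab P d j \<noteq> 0"
  shows "reaches P (vlab P d j) (vedge (m - d) j)"
  using assms(2-)
proof (induction d arbitrary: j)
  case (Suc d)
  let ?i = "m - d"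
  have i: "?i \<in> {1..m}" "m - ?i = d" "?i - 1 = m - Suc d" using Suc.prems by auto
  note P' = P[unfolded pipe_dreams_iff]
  have tiles: "P (?i, j) \<in> tiles (\<beta> ?i)" if "j \<in> {1..n}" for j
    using P' i that by (auto simp: grid_def PiE_def Pi_def)
  have v: "vlab P (m - ?i) (col ?i t) \<noteq> 0 \<Longrightarrow> reaches P (vlab P (m - ?i) (col ?i t)) (vedge ?i (col ?i t))"
    if "t \<in> {1..n}" for t
    using Suc.IH[OF _ col_range[OF that, of ?i]] Suc.prems(1) i by simp
  have h: "hlab P ?i t \<noteq> 0 \<longrightarrow> reaches P (hlab P ?i t) (hedge ?i t)" if "t \<le> n" for t
    using that
  proof (induction t)
    case 0
    then show ?case using i by (auto simp: reaches_def hlab_0 entry_point_hedge)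
  next
    case (Suc t)
    then have t: "Suc t \<in> {1..n}" by simp
    show ?case
      using cell_reaches(1)[OF tiles[OF col_range[OF t, of ?i]] i(1) t _ _ v[OF t]] Suc P' i(1) t by simp
  qed
  define t where "t = col ?i j"
  have t: "t \<in> {1..n}" "col ?i t = j" using col_range[OF Suc.prems(2), of ?i] col_col[OF Suc.prems(2), of ?i] by (auto simp: t_def)
  have "hlab P ?i (t - 1) \<noteq> 0 \<Longrightarrow> reaches P (hlab P ?i (t - 1)) (hedge ?i (t - 1))" using h[of "t - 1"] t by auto
  then have "vlab P (Suc (m - ?i)) (col ?i t) \<noteq> 0 \<Longrightarrow> reaches P (vlab P (Suc (m - ?i)) (col ?i t)) (vedge (?i - 1) (col ?i t))"
    using cell_reaches(2)[OF tiles[OF col_range[OF t(1), of ?i]] i(1) t(1) _ _ v[OF t(1)]] P' i(1) t(1) by blast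
  then show ?case using Suc.prems(3) unfolding i t(2) by blast
qed simp

text \<open>Labels are constant along paths, which gives one direction. Conversely a nonzero label
  is joined to an entry with that number, and \<open>inj_pipe_number\<close> makes the entry
  unique.\<close>

lemma has_connectivity_iff:
  assumes P: "P \<in> pipe_dreams m n \<beta>" and \<pi>: "\<pi> \<in> {1..m} \<rightarrow> {1..n}"
  shows "has_connectivity m n \<beta> P \<pi> \<longleftrightarrow> (\<forall>p\<in>{1..m}. vlab P m (\<pi> p) = p)"
proof
  have tiles: "P (i, j) \<in> tiles (\<beta> i)" if "i \<in> {1..m}" "j \<in> {1..n}" for i j
    using P[unfolded pipe_dreams_iff] that by (auto simp: grid_def PiE_def Pi_def)
  assume conn: "has_connectivity m n \<beta> P \<pi>"
  show "\<forall>p\<in>{1..m}. vlab P m (\<pi> p) = p"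
  proof
    fix p assume "p \<in> {1..m}"
    then obtain i where i: "i \<in> {1..m}" "pipe_number m \<beta> i = p" using pipe_number_surj by blast
    then have "(entry_point n \<beta> i, midpoint (1, \<pi> p) North) \<in> (segments m n P)\<^sup>*"
      using conn by (auto simp: has_connectivity_def)
    then have "label P (hedge i 0) = label P (midpoint (1, \<pi> p) North)"
      using label_path tiles by (auto simp: entry_point_hedge)
    moreover have "label P (hedge i 0) = p" using i by (simp add: label_def hedge_def hlab_0)
    ultimately show "vlab P m (\<pi> p) = p" by (simp add: label_def)
  qed
next
  assume *: "\<forall>p\<in>{1..m}. vlab P m (\<pi> p) = p"
  show "has_connectivity m n \<beta> P \<pi>"
    unfolding has_connectivity_def
  proof
    fix i assume i: "i \<in> {1..m}"
    let ?p = "pipe_number m \<beta> i"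
    have p: "?p \<in> {1..m}" using pipe_number_range[OF i] .
    then have "reaches P ?p (vedge 0 (\<pi> ?p))"
      using vlab_reaches[OF P, of m "\<pi> ?p"] * \<pi> by (auto simp: Pi_def)
    then obtain i' where "i' \<in> {1..m}" "pipe_number m \<beta> i' = ?p"
      "(entry_point n \<beta> i', vedge 0 (\<pi> ?p)) \<in> (segments m n P)\<^sup>*"
      by (auto simp: reaches_def)
    moreover from this have "i' = i" using i inj_pipe_number by (metis inj_onD)
    ultimately show "(entry_point n \<beta> i, midpoint (1, \<pi> ?p) North) \<in> (segments m n P)\<^sup>*"
      by (simp add: vedge_def)
  qed
qed

end

section \<open>The generating polynomials\<close>

lemma row_hom:
  assumes "\<And>x y. \<phi> (x + y) = \<phi> x + \<phi> y" "\<And>x y. \<phi> (x - y) = \<phi> x - \<phi> y" "\<And>x y. \<phi> (x * y) = \<phi> x * \<phi> y"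
  shows "\<phi> (row c a js h s f) = row (\<phi> c) (\<lambda>j. \<phi> (a j)) js h s (\<lambda>h s. \<phi> (f h s))"
  by (induction js arbitrary: h s) (auto simp: assms)

locale weighted_grid = labelled_grid m n \<beta> + pipe_weights A B Y n
  for m n :: nat and \<beta> :: "nat \<Rightarrow> row_type" and A B :: "'a::idom" and Y :: "nat \<Rightarrow> 'a"
begin

lemma row_cells_eq: "row_cells i = map (Pair i) (columns (\<beta> i))"
proof -
  have "columns (\<beta> i) = map (col i) [1..<Suc n]"
  proof (cases "\<beta> i")
    case w_row
    then show ?thesis by (simp add: col_def map_idI)
  next
    case e_row
    have "rev [1..<Suc n] = map (\<lambda>t. Suc n - t) [1..<Suc n]"
      by (rule nth_equalityI) (auto simp: rev_nth simp del: upt_Suc)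
    then show ?thesis using e_row by (simp add: col_def del: upt_Suc)
  qed
  then show ?thesis by (simp add: row_cells_def del: upt_Suc)
qed

definition cell_weight :: "(nat \<Rightarrow> 'a) \<Rightarrow> nat \<times> nat \<Rightarrow> 'a" where
  "cell_weight X = (\<lambda>(i, j). straight (\<beta> i) (X (pipe_number m \<beta> i)) j)"

primrec rows :: "(nat \<Rightarrow> 'a) \<Rightarrow> nat \<Rightarrow> ((nat \<Rightarrow> nat) \<Rightarrow> 'a) \<Rightarrow> (nat \<Rightarrow> nat) \<Rightarrow> 'a" where
  "rows X 0 g = g"
| "rows X (Suc k) g = transfer X (\<beta> (Suc k)) (pipe_number m \<beta> (Suc k)) (rows X k g)"

lemma cell_sum_rows:
  assumes "k \<le> m" "\<And>i. i \<in> {1..m} \<Longrightarrow> hs i = (if i \<le> k then pipe_number m \<beta> i else 0)"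
  shows "cell_sum (A + B) (cell_weight X) (cells k) hs vs (\<lambda>hs vs. if \<forall>i\<in>{1..m}. hs i = 0 then g vs else 0)
    = rows X k g vs"
  using assms
proof (induction k arbitrary: hs vs)
  case 0
  then show ?case by simp
next
  case (Suc k)
  let ?i = "Suc k" and ?f = "\<lambda>hs vs. if \<forall>i\<in>{1..m}. hs i = 0 then g vs else (0::'a)"
  have i: "?i \<in> {1..m}" using Suc.prems by simp
  have "cell_sum (A + B) (cell_weight X) (cells k) (hs(?i := h)) s ?f = (if h = 0 then rows X k g s else 0)" for h s
  proof (cases "h = 0")
    case True
    have "cell_sum (A + B) (cell_weight X) (cells k) (hs(?i := h)) s ?f = rows X k g s"
      by (rule Suc.IH) (use Suc.prems True in auto)
    then show ?thesis using True by simp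
  next
    case False
    have "?i \<notin> fst ` set (cells k)" by (auto simp: set_cells)
    then show ?thesis using False i by (auto intro!: cell_sum_zero)
  qed
  then show ?case
    using Suc.prems(2)[OF i]
    by (simp add: row_cells_eq cell_sum_row transfer_def cell_weight_def)
qed

text \<open>Among the top \<open>k\<close> rows exactly those of type \<open>w_row\<close> have
  taken labels from the lower end, so the labels left start just after their number.\<close>

lemma rows_block:
  assumes "k \<le> m"
  shows "block X (map \<beta> [Suc k..<Suc m]) (Suc (card {l\<in>{1..k}. \<beta> l = w_row})) (rows X k g) = block X (map \<beta> [1..<Suc m]) 1 g"
  using assms
proof (induction k)
  case (Suc k)
  have upt: "[Suc k..<Suc m] = Suc k # [Suc (Suc k)..<Suc m]" using Suc.prems by (intro upt_conv_Cons) simp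
  show ?case
  proof (cases "\<beta> (Suc k)")
    case w_row
    have "{l\<in>{1..Suc k}. \<beta> l = w_row} = insert (Suc k) {l\<in>{1..k}. \<beta> l = w_row}" using w_row by (auto simp: le_Suc_eq)
    then have "card {l\<in>{1..Suc k}. \<beta> l = w_row} = Suc (card {l\<in>{1..k}. \<beta> l = w_row})" by simp
    then show ?thesis using Suc w_row pipe_number_w[of \<beta> k m] by (simp add: upt del: upt_Suc)
  next
    case e_row
    have "{l\<in>{1..Suc k}. \<beta> l = w_row} = {l\<in>{1..k}. \<beta> l = w_row}" using e_row by (auto simp: le_Suc_eq)
    moreover have "length (map \<beta> [Suc (Suc k)..<Suc m]) = m - Suc k" by (simp del: upt_Suc)
    ultimately show ?thesis using Suc e_row pipe_number_e[of \<beta> k m]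
      by (simp only: upt list.map block.simps rows.simps)
  qed
qed simp

lemma sum_pipe_dreams:
  assumes \<pi>: "\<pi> \<in> perms {1..m}"
  shows "(\<Sum>P\<in>{P \<in> pipe_dreams m n \<beta>. has_connectivity m n \<beta> P \<pi>}.
      \<Prod>c\<in>grid m n. weight_of \<beta> (A + B) (cell_weight X) P c) = block X (map \<beta> [1..<Suc m]) 1 (target {1..m} \<pi>)"
proof -
  let ?f = "\<lambda>hs vs. if \<forall>i\<in>{1..m}. hs i = 0 then target {1..m} \<pi> vs else (0::'a)"
  let ?F = "\<Pi>\<^sub>E (i, j)\<in>grid m n. tiles (\<beta> i)"
  have grid: "set (cells m) = grid m n" by (simp add: set_cells grid_def)
  have fin: "finite ?F" by (rule finite_PiE) (auto simp: grid_def finite_tiles)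
  have "block X (map \<beta> [1..<Suc m]) 1 (target {1..m} \<pi>) = rows X m (target {1..m} \<pi>) (\<lambda>_. 0)"
    using rows_block[of m X "target {1..m} \<pi>"] by simp
  also have "\<dots> = cell_sum (A + B) (cell_weight X) (cells m) (pipe_number m \<beta>) (\<lambda>_. 0) ?f"
    by (rule cell_sum_rows[symmetric]) auto
  also have "\<dots> = (\<Sum>P\<in>?F. if P \<in> pipe_dreams m n \<beta> \<and> has_connectivity m n \<beta> P \<pi>
      then \<Prod>c\<in>grid m n. weight_of \<beta> (A + B) (cell_weight X) P c else 0)"
    unfolding cell_sum_fillings[OF distinct_cells, where \<beta> = \<beta>] grid
  proof (rule sum.cong[OF refl])
    fix P assume P: "P \<in> ?F"
    have hs: "(\<lambda>i. if i \<in> {m<..m} then hlab P i n else pipe_number m \<beta> i) = pipe_number m \<beta>" by auto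
    note tr = traverse_cells[of m P, unfolded hs diff_self_eq_0 vlab.simps(1), OF le_refl]
    have fin: "?f (\<lambda>i. if i \<in> {0<..m} then hlab P i n else pipe_number m \<beta> i) (vlab P m) =
      (if (\<forall>i\<in>{1..m}. hlab P i n = 0) \<and> (\<forall>p\<in>{1..m}. vlab P m (\<pi> p) = p) then 1 else 0)"
      by (auto simp: target_def)
    have "P \<in> pipe_dreams m n \<beta> \<and> has_connectivity m n \<beta> P \<pi> \<longleftrightarrow>
       (\<forall>i\<in>{1..m}. \<forall>t\<in>{1..n}. cell_fits P i t) \<and> (\<forall>i\<in>{1..m}. hlab P i n = 0) \<and> (\<forall>p\<in>{1..m}. vlab P m (\<pi> p) = p)"
      using P pipe_dreams_iff[of P] has_connectivity_iff[of P \<pi>] \<pi> by (auto simp: perms_def PiE_def)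
    then show "(if fits \<beta> P (cells m) (pipe_number m \<beta>) (\<lambda>_. 0)
        then (\<Prod>x\<in>grid m n. weight_of \<beta> (A + B) (cell_weight X) P x) *
          (case run (elbow_at \<beta> P) (cells m) (pipe_number m \<beta>) (\<lambda>_. 0) of (hs, vs) \<Rightarrow> ?f hs vs) else 0) =
      (if P \<in> pipe_dreams m n \<beta> \<and> has_connectivity m n \<beta> P \<pi>
        then \<Prod>c\<in>grid m n. weight_of \<beta> (A + B) (cell_weight X) P c else 0)"
      unfolding tr prod.case fin by simp
  qed
  also have "\<dots> = (\<Sum>P\<in>{P\<in>?F. P \<in> pipe_dreams m n \<beta> \<and> has_connectivity m n \<beta> P \<pi>}.
      \<Prod>c\<in>grid m n. weight_of \<beta> (A + B) (cell_weight X) P c)"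
    by (rule sum.inter_filter[OF fin, symmetric])
  also have "{P\<in>?F. P \<in> pipe_dreams m n \<beta> \<and> has_connectivity m n \<beta> P \<pi>} =
      {P \<in> pipe_dreams m n \<beta>. has_connectivity m n \<beta> P \<pi>}" by (auto simp: pipe_dreams_def)
  finally show ?thesis by simp
qed

end

section \<open>The action of the transposition as a ring automorphism\<close>

lemma poly_mapping_add_induct [case_names zero add_single]:
  fixes p :: "'k \<Rightarrow>\<^sub>0 'b::comm_monoid_add"
  assumes "P 0" "\<And>p k v. P p \<Longrightarrow> P (p + Poly_Mapping.single k v)"
  shows "P p"
proof (induction p rule: update_induct)
  case (update p k v)
  have "Poly_Mapping.update k v p = p + Poly_Mapping.single k v"
    using update by (intro poly_mapping_eqI) (auto simp: lookup_add lookup_update lookup_single when_def in_keys_iff)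
  then show ?case using assms(2) update by simp
qed (rule assms)

context
  fixes i :: nat
begin

definition swap_indet :: "indet \<Rightarrow> indet" where
  "swap_indet = transpose (Ind_x i) (Ind_x (Suc i))"

definition swap_monomial :: "(indet \<Rightarrow>\<^sub>0 nat) \<Rightarrow> (indet \<Rightarrow>\<^sub>0 nat)" where
  "swap_monomial = Poly_Mapping.map_key swap_indet"

lemma inj_swap_indet: "inj swap_indet"
  by (simp add: swap_indet_def)

lemma swap_monomial_add: "swap_monomial (\<mu> + \<nu>) = swap_monomial \<mu> + swap_monomial \<nu>"
  unfolding swap_monomial_def by (rule map_key_plus[OF inj_swap_indet])

lemma swap_monomial_involutory: "swap_monomial (swap_monomial \<mu>) = \<mu>"
proof -
  have "swap_indet \<circ> swap_indet = (\<lambda>x. x)" by (auto simp: swap_indet_def)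
  then show ?thesis
    unfolding swap_monomial_def map_key_compose[OF inj_swap_indet inj_swap_indet] by (simp add: map_key_id)
qed

lemma inj_swap_monomial: "inj swap_monomial"
  by (metis swap_monomial_involutory injI)

lemma swap_x_eq: "swap_x i = Poly_Mapping.map_key swap_monomial"
  by (simp add: swap_x_def swap_monomial_def swap_indet_def)

lemma swap_x_single: "swap_x i (Poly_Mapping.single \<mu> v) = Poly_Mapping.single (swap_monomial \<mu>) v"
  unfolding swap_x_eq
  using map_key_single[OF inj_swap_monomial, of "swap_monomial \<mu>" v] by (simp add: swap_monomial_involutory)

lemma swap_x_add: "swap_x i (p + q) = swap_x i p + swap_x i q"
  unfolding swap_x_eq by (rule map_key_plus[OF inj_swap_monomial])

lemma swap_x_0: "swap_x i 0 = 0"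
  unfolding swap_x_eq by (rule map_key_zero[OF inj_swap_monomial])

lemma swap_x_diff: "swap_x i (p - q) = swap_x i p - swap_x i q"
  using swap_x_add[of "p - q" q] by simp

lemma swap_x_mult: "swap_x i (p * q) = swap_x i p * swap_x i q"
proof (induction p rule: poly_mapping_add_induct)
  case (add_single p \<mu> v)
  have "swap_x i (Poly_Mapping.single \<mu> v * q) = swap_x i (Poly_Mapping.single \<mu> v) * swap_x i q"
    by (induction q rule: poly_mapping_add_induct)
      (simp_all add: swap_x_0 swap_x_add swap_x_single mult_single swap_monomial_add distrib_left)
  then show ?case using add_single by (simp add: distrib_right swap_x_add)
qed (simp add: swap_x_0)

lemma swap_x_1: "swap_x i 1 = 1"
proof -
  have "swap_monomial 0 = 0" unfolding swap_monomial_def by (rule map_key_zero[OF inj_swap_indet])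
  then show ?thesis using swap_x_single[of 0 1] by simp
qed

lemma swap_x_indet: "swap_x i (indet_poly v) = indet_poly (swap_indet v)"
proof -
  have "swap_monomial (Poly_Mapping.single v 1) = Poly_Mapping.single (swap_indet v) 1"
    using map_key_single[OF inj_swap_indet, of "swap_indet v" 1]
    unfolding swap_monomial_def by (simp add: swap_indet_def del: One_nat_def)
  then show ?thesis by (simp add: indet_poly_def swap_x_single)
qed

lemma swap_x_indets:
  "swap_x i (pX k) = pX (transpose i (Suc i) k)" "swap_x i (pY k) = pY k" "swap_x i pA = pA" "swap_x i pB = pB"
  by (auto simp: swap_x_indet swap_indet_def transpose_def)

end

lemma inj_indet_poly: "inj indet_poly"
proof (rule injI)
  fix u v assume "indet_poly u = indet_poly v"
  then have "Poly_Mapping.keys (indet_poly u) = Poly_Mapping.keys (indet_poly v)" by simp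
  then have "Poly_Mapping.single u (1::nat) = Poly_Mapping.single v 1" by (simp add: indet_poly_def)
  then have "Poly_Mapping.keys (Poly_Mapping.single u (1::nat)) = Poly_Mapping.keys (Poly_Mapping.single v (1::nat))" by simp
  then show "u = v" by simp
qed

lemma inj_pX: "inj pX"
  using inj_indet_poly by (auto simp: inj_def)

lemma pX_diff_nonzero: "pX i - pX (Suc i) \<noteq> 0"
  using injD[OF inj_pX, of i "Suc i"] by auto

interpretation poly_weights: pipe_weights pA pB pY n for n .

text \<open>A block is built from ring operations, and the automorphism fixes A, B and the y's; so
  it acts only on \<open>X\<close> and on the final function.\<close>

lemma swap_x_block:
  "swap_x i (poly_weights.block n X bs lo f) = poly_weights.block n (\<lambda>k. swap_x i (X k)) bs lo (\<lambda>s. swap_x i (f s))"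
proof -
  have tr: "swap_x i (poly_weights.transfer n X t k f s) =
      poly_weights.transfer n (\<lambda>k. swap_x i (X k)) t k (\<lambda>s. swap_x i (f s)) s" for n X t k f s
  proof -
    have st: "swap_x i (poly_weights.straight t (X k) j) = poly_weights.straight t (swap_x i (X k)) j" for j
      by (cases t) (simp_all add: swap_x_add swap_x_diff swap_x_indets)
    have if0: "swap_x i (if h = 0 then f s else 0) = (if h = 0 then swap_x i (f s) else 0)" for h :: nat and s
      by (simp add: swap_x_0)
    show ?thesis
      unfolding poly_weights.transfer_def
      by (simp only: row_hom[of "swap_x i", OF swap_x_add swap_x_diff swap_x_mult] st if0 swap_x_add swap_x_indets)
  qed
  show ?thesis by (induction X bs lo f rule: poly_weights.block.induct) (simp_all add: tr)
qed

section \<open>Membership in the polynomial ring\<close>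

lemma poly_ring_0: "0 \<in> poly_ring m n" and poly_ring_1: "1 \<in> poly_ring m n"
  by (auto simp: poly_ring_def)

lemma poly_ring_add: "p \<in> poly_ring m n \<Longrightarrow> q \<in> poly_ring m n \<Longrightarrow> p + q \<in> poly_ring m n"
  using keys_add[of p q] by (auto simp: poly_ring_def)

lemma poly_ring_diff: "p \<in> poly_ring m n \<Longrightarrow> q \<in> poly_ring m n \<Longrightarrow> p - q \<in> poly_ring m n"
  using keys_diff[of p q] by (auto simp: poly_ring_def)

lemma poly_ring_mult:
  assumes "p \<in> poly_ring m n" "q \<in> poly_ring m n"
  shows "p * q \<in> poly_ring m n"
proof -
  let ?V = "Ind_x ` {1..m} \<union> Ind_y ` {1..n} \<union> {Ind_A, Ind_B}"
  have "Poly_Mapping.keys \<mu> \<subseteq> ?V" if \<mu>: "\<mu> \<in> Poly_Mapping.keys (p * q)" for \<mu>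
  proof -
    obtain a b where "\<mu> = a + b" "a \<in> Poly_Mapping.keys p" "b \<in> Poly_Mapping.keys q"
      using \<mu> keys_mult[of p q] by blast
    moreover from this have "Poly_Mapping.keys a \<subseteq> ?V" "Poly_Mapping.keys b \<subseteq> ?V"
      using assms unfolding poly_ring_def by blast+
    ultimately show ?thesis using keys_add[of a b] by blast
  qed
  then show ?thesis unfolding poly_ring_def by blast
qed

lemma poly_ring_sum: "(\<And>x. x \<in> S \<Longrightarrow> f x \<in> poly_ring m n) \<Longrightarrow> sum f S \<in> poly_ring m n"
  by (induction S rule: infinite_finite_induct) (auto intro: poly_ring_add poly_ring_0)

lemma poly_ring_prod: "(\<And>x. x \<in> S \<Longrightarrow> f x \<in> poly_ring m n) \<Longrightarrow> prod f S \<in> poly_ring m n"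
  by (induction S rule: infinite_finite_induct) (auto intro: poly_ring_mult poly_ring_1)

lemma poly_ring_indets:
  "k \<in> {1..m} \<Longrightarrow> pX k \<in> poly_ring m n" "k \<in> {1..n} \<Longrightarrow> pY k \<in> poly_ring m n"
  "pA \<in> poly_ring m n" "pB \<in> poly_ring m n"
  by (auto simp: poly_ring_def indet_poly_def)

lemma G_poly_in_poly_ring: "G_poly m n \<beta> \<pi> \<in> poly_ring m n"
proof -
  have "tile_weight m \<beta> P c \<in> poly_ring m n" if c_in: "c \<in> grid m n" for P c
  proof -
    obtain i j where c: "c = (i, j)" "i \<in> {1..m}" "j \<in> {1..n}" using c_in by (auto simp: grid_def)
    note in_ring = poly_ring_indets(1)[OF pipe_number_range[OF c(2)]] poly_ring_indets(2)[OF c(3)] poly_ring_indets(3,4)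
    show ?thesis
      by (cases "\<beta> i") (auto simp: tile_weight_def c(1) Let_def intro!: poly_ring_add poly_ring_diff in_ring)
  qed
  then show ?thesis unfolding G_poly_def by (intro poly_ring_sum poly_ring_prod)
qed

section \<open>Both relations and uniqueness for the generating polynomials\<close>

lemma partial_perms_eq: "partial_perms m n = pipe_weights.perms n {1..<1 + m}"
  by (auto simp: partial_perms_def pipe_weights.perms_def atLeastLessThanSuc_atLeastAtMost)

lemma G_poly_eq_block:
  assumes "1 \<le> m" "m \<le> n" "\<pi> \<in> partial_perms m n"
  shows "G_poly m n \<beta> \<pi> = poly_weights.block n pX (map \<beta> [1..<Suc m]) 1 (poly_weights.target {1..<1 + m} \<pi>)"
proof -
  interpret weighted_grid m n \<beta> pA pB pY by unfold_locales (use assms in auto)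
  have "tile_weight m \<beta> P c = weight_of \<beta> (pA + pB) (cell_weight pX) P c" for P c
    by (cases c; cases "\<beta> (fst c)") (auto simp: tile_weight_def weight_of_def elbow_at_def cell_weight_def Let_def)
  then show ?thesis
    using sum_pipe_dreams[of \<pi> pX] assms(3)
    by (simp add: G_poly_def partial_perms_eq atLeastLessThanSuc_atLeastAtMost)
qed

lemma G_poly_exchange:
  assumes "1 \<le> m" "m \<le> n" "\<pi> \<in> partial_perms m n" "i \<in> {1..<m}"
  shows "(pX i - pX (Suc i)) * G_poly m n \<beta> \<pi> = (pA + pB) * G_poly m n \<beta> (\<pi> \<circ> transpose i (Suc i))
    - (pA + pB + pX i - pX (Suc i)) * swap_x i (G_poly m n \<beta> (\<pi> \<circ> transpose i (Suc i)))"
proof -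
  let ?K = "{1..<1 + m}" and ?bs = "map \<beta> [1..<Suc m]" and ?\<tau> = "transpose i (Suc i)"
  have i: "i \<in> ?K" "Suc i \<in> ?K" using assms(4) by auto
  have \<pi>': "\<pi> \<circ> ?\<tau> \<in> partial_perms m n"
    using assms(3) i unfolding partial_perms_eq by (intro poly_weights.perms_transpose)
  have tgt: "(\<lambda>s. poly_weights.target ?K \<pi> (\<lambda>j. ?\<tau> (s j))) = poly_weights.target ?K (\<pi> \<circ> ?\<tau>)"
    by (intro ext poly_weights.target_transpose i)
  have sw: "poly_weights.block n (pX \<circ> ?\<tau>) ?bs 1 (poly_weights.target ?K (\<pi> \<circ> ?\<tau>)) =
      swap_x i (poly_weights.block n pX ?bs 1 (poly_weights.target ?K (\<pi> \<circ> ?\<tau>)))"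
  proof -
    have "swap_x i (poly_weights.target ?K \<rho> s) = poly_weights.target ?K \<rho> s" for \<rho> s
      by (simp add: poly_weights.target_def swap_x_0 swap_x_1)
    then show ?thesis by (simp add: swap_x_block swap_x_indets o_def)
  qed
  have "(pX i - pX (Suc i)) * poly_weights.block n pX ?bs 1 (poly_weights.target ?K \<pi>) =
      (pA + pB) * poly_weights.block n pX ?bs 1 (poly_weights.target ?K (\<pi> \<circ> ?\<tau>))
      - (pA + pB + (pX i - pX (Suc i))) * swap_x i (poly_weights.block n pX ?bs 1 (poly_weights.target ?K (\<pi> \<circ> ?\<tau>)))"
    using poly_weights.exchanges[of n m, unfolded poly_weights.exchanges_def, rule_format, of ?bs 1 pX i "poly_weights.target ?K \<pi>"]
      assms(4) inj_pX unfolding tgt sw by simp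
  then show ?thesis
    using G_poly_eq_block[OF assms(1,2)] assms(3) \<pi>' by (simp add: add_diff_eq)
qed

lemma to_fract_divide_iff:
  assumes "d \<noteq> 0"
  shows "to_fract x = 1 / to_fract d * to_fract y \<longleftrightarrow> d * x = y"
proof -
  have "to_fract x = 1 / to_fract d * to_fract y \<longleftrightarrow> to_fract d * to_fract x = to_fract y"
    using assms by (auto simp: field_simps simp del: to_fract_mult)
  then show ?thesis by (simp flip: to_fract_mult)
qed

lemma exchange_formula_iff:
  "exchange_formula m n F \<longleftrightarrow> (\<forall>\<pi>\<in>partial_perms m n. \<forall>i\<in>{1..<m}.
     (pX i - pX (Suc i)) * F \<pi> = (pA + pB) * F (\<pi> \<circ> transpose i (Suc i))
       - (pA + pB + pX i - pX (Suc i)) * swap_x i (F (\<pi> \<circ> transpose i (Suc i))))"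
  unfolding exchange_formula_def Let_def by (simp only: to_fract_divide_iff[OF pX_diff_nonzero])

theorem theorem3p7:
  fixes m n :: nat and \<beta> :: "nat \<Rightarrow> row_type"
  assumes "1 \<le> m" and "m \<le> n"
  shows "(\<forall>\<pi>\<in>partial_perms m n. G_poly m n \<beta> \<pi> \<in> poly_ring m n)
    \<and> decreasing_formula m n (G_poly m n \<beta>)
    \<and> exchange_formula m n (G_poly m n \<beta>)
    \<and> (\<forall>F. (\<forall>\<pi>\<in>partial_perms m n. F \<pi> \<in> poly_ring m n)
          \<longrightarrow> decreasing_formula m n F \<longrightarrow> exchange_formula m n F
          \<longrightarrow> (\<forall>\<pi>\<in>partial_perms m n. F \<pi> = G_poly m n \<beta> \<pi>))"
proof (intro conjI allI impI)
  have K: "{1..<1 + m} = {1..m}" by auto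
  show "\<forall>\<pi>\<in>partial_perms m n. G_poly m n \<beta> \<pi> \<in> poly_ring m n" using G_poly_in_poly_ring by blast
  show dec: "decreasing_formula m n (G_poly m n \<beta>)"
    unfolding decreasing_formula_def
  proof (intro ballI impI)
    fix \<pi> assume \<pi>: "\<pi> \<in> partial_perms m n" and anti: "strict_antimono_on {1..m} \<pi>"
    have len: "length (map \<beta> [1..<Suc m]) = m" by simp
    show "G_poly m n \<beta> \<pi> = (\<Prod>i\<in>{1..m}. (pA + pB) * (\<Prod>j\<in>{1..<\<pi> i}. pA + pX i - pY j)
                                      * (\<Prod>j\<in>{\<pi> i<..n}. pB - pX i + pY j))"
      using poly_weights.block_antimono[of 1 \<pi> n "map \<beta> [1..<Suc m]" pX, unfolded len]
        \<pi> anti G_poly_eq_block[OF assms \<pi>]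
      unfolding partial_perms_eq K poly_weights.antimono_product_def by simp
  qed
  show ex: "exchange_formula m n (G_poly m n \<beta>)"
    unfolding exchange_formula_iff using G_poly_exchange assms by blast
  fix F assume F: "decreasing_formula m n F" "exchange_formula m n F"
  show "\<forall>\<pi>\<in>partial_perms m n. F \<pi> = G_poly m n \<beta> \<pi>"
  proof
    fix \<pi> assume "\<pi> \<in> partial_perms m n"
    then show "F \<pi> = G_poly m n \<beta> \<pi>"
      unfolding partial_perms_eq
    proof (induction rule: poly_weights.perms_induct)
      case (antimono \<pi>)
      then show ?case using F(1) dec unfolding decreasing_formula_def partial_perms_eq K by simp
    next
      case (exchange \<pi> i)
      then have "\<pi> \<in> partial_perms m n" "i \<in> {1..<m}" by (auto simp: partial_perms_eq)
      then have "(pX i - pX (Suc i)) * F \<pi> = (pX i - pX (Suc i)) * G_poly m n \<beta> \<pi>"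
        using F(2)[unfolded exchange_formula_iff] ex[unfolded exchange_formula_iff] by (simp only: exchange.IH)
      then show ?case using pX_diff_nonzero by simp
    qed
  qed
qed

end
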